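(* Let $(W,S)$ be a Coxeter system, let $\beta\in\Phi^+$ and let $t=s_\beta\in T$ be the corresponding reflection. For any $t$-prefix $p_t$ we have $$\operatorname{Dom}(\beta)=\{\alpha\in\Phi(p_t)\mid B(\alpha,\beta)\ge 1\}=\{\beta\}\sqcup\{\alpha_s\in\Phi(p_t)\mid s\in T,\ |\langle s,t\rangle|=\infty\}.$$ In particular, $\operatorname{dp}_\infty(\beta)=|\{\alpha_s\in\Phi(p_t)\mid s\in T,\ |\langle s,t\rangle|=\infty\}|$.
   Context: $(W,S)$ is a Coxeter system with $S$ finite, length function $\ell$, and set of reflections $T=\bigcup_{w\in W}wSw^{-1}$. Geometric representation: $V$ is a finite-dimensional real vector space with a symmetric bilinear form $B$, and $\Delta=\{\alpha_s\mid s\in S\}\subset V$ is such that: if $\sum a_s\alpha_s=0$ with all $a_s\ge 0$ then all $a_s=0$; $B(\alpha_s,\alpha_s)=1$; for $s\ne t$, $B(\alpha_s,\alpha_t)=-\cos(\pi/m_{st})$ if the order $m_{st}$ of $st$ is finite and $B(\alpha_s,\alpha_t)\le -1$ if $m_{st}=\infty$. $W$ acts faithfully on $V$ by $s(v)=v-2B(\alpha_s,v)\alpha_s$. $\Phi=W(\Delta)$ is the root system, $\Phi^+=\Phi\cap\operatorname{cone}(\Delta)$, $\Phi^-=-\Phi^+$. For $t\in T$, $\alpha_t\in\Phi^+$ is the unique positive root whose associated reflection is $t$, and $s_\beta\in T$ is the reflection of $\beta\in\Phi^+$. The inversion set of $w$ is $\Phi(w)=\{\alpha\in\Phi^+\mid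 w^{-1}(\alpha)\in\Phi^-\}$. Dominance order on $\Phi^+$: $\alpha\le_d\beta$ iff for every $w\in W$, $\beta\in\Phi(w)$ implies $\alpha\in\Phi(w)$. $\operatorname{Dom}(\beta)=\{\alpha\in\Phi^+\mid\alpha\le_d\beta\}$ and $\operatorname{dp}_\infty(\beta)=|\operatorname{Dom}(\beta)|-1$. For $t\in T$, a $t$-prefix is an element $p\in W$, $p\neq e$, such that for any reduced word $p=s_1\cdots s_{k+1}$ the word $s_1\cdots s_ks_{k+1}s_k\cdots s_1$ is a (palindromic) reduced word for $t$. $\langle s,t\rangle$ is the subgroup of $W$ generated by $s$ and $t$. *)

theory Defs
  imports "HOL-Analysis.Analysis" "HOL-Algebra.Group_Action" "HOL-Algebra.Generated_Groups" "HOL-Algebra.Multiplicative_Group"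
begin

section \<open>Coxeter systems\<close>

definition word_prod :: "('g, 'm) monoid_scheme \<Rightarrow> 'g list \<Rightarrow> 'g" where
  "word_prod W ws = foldr (\<lambda>x y. x \<otimes>\<^bsub>W\<^esub> y) ws \<one>\<^bsub>W\<^esub>"

text \<open>
  Deletion of one occurrence of a defining relator \<open>(st)^m\<close>, with \<open>m\<close> the order of \<open>st\<close>.
  For \<open>s = t\<close> this is the deletion of \<open>ss\<close>.  If \<open>st\<close> has infinite order then
  \<open>group.ord\<close> is \<open>0\<close>, the relator is the empty word, and no relation is imposed.
\<close>

definition relator_step :: "('g, 'm) monoid_scheme \<Rightarrow> 'g set \<Rightarrow> 'g list \<Rightarrow> 'g list \<Rightarrow> bool" where
  "relator_step W S us vs \<longleftrightarrow>
     (\<exists>xs\<in>lists S. \<exists>ys\<in>lists S. \<exists>s\<in>S. \<exists>t\<in>S.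
        us = xs @ concat (replicate (group.ord W (s \<otimes>\<^bsub>W\<^esub> t)) [s, t]) @ ys \<and> vs = xs @ ys)"

text \<open>
  \<open>W\<close> is presented by \<open>\<langle>S | (st)^m(s,t) = e\<rangle>\<close>.  The relations make every generator its
  own inverse, so words in \<open>S\<close> (without formal inverses) suffice: the assumption \<open>presentation\<close> says
  that a word trivial in \<open>W\<close> reduces to the empty word by inserting and deleting relators.
\<close>

locale coxeter_system = group W for W :: "('g, 'm) monoid_scheme" (structure) +
  fixes S :: "'g set"
  assumes finite_gens: "finite S"
    and gens_closed: "S \<subseteq> carrier W"
    and gens_generate: "generate W S = carrier W"
    and gens_order: "\<And>s. s \<in> S \<Longrightarrow> ord s = 2"
    and presentation: "\<And>ws. ws \<in> lists S \<Longrightarrow> word_prod W ws = \<one> \<Longrightarrow> equivclp (relator_step W S) ws []"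

definition cox_length :: "('g, 'm) monoid_scheme \<Rightarrow> 'g set \<Rightarrow> 'g \<Rightarrow> nat" where
  "cox_length W S w = (LEAST n. \<exists>ws\<in>lists S. word_prod W ws = w \<and> length ws = n)"

definition reduced_word_for :: "('g, 'm) monoid_scheme \<Rightarrow> 'g set \<Rightarrow> 'g \<Rightarrow> 'g list \<Rightarrow> bool" where
  "reduced_word_for W S w ws \<longleftrightarrow>
     ws \<in> lists S \<and> word_prod W ws = w \<and> length ws = cox_length W S w"

definition reflections :: "('g, 'm) monoid_scheme \<Rightarrow> 'g set \<Rightarrow> 'g set" where
  "reflections W S = {w \<otimes>\<^bsub>W\<^esub> s \<otimes>\<^bsub>W\<^esub> inv\<^bsub>W\<^esub> w | w s. w \<in> carrier W \<and> s \<in> S}"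

definition is_prefix_of_refl :: "('g, 'm) monoid_scheme \<Rightarrow> 'g set \<Rightarrow> 'g \<Rightarrow> 'g \<Rightarrow> bool" where
  "is_prefix_of_refl W S t p \<longleftrightarrow>
     p \<in> carrier W \<and> p \<noteq> \<one>\<^bsub>W\<^esub> \<and>
     (\<forall>ws s. reduced_word_for W S p (ws @ [s]) \<longrightarrow> reduced_word_for W S t (ws @ [s] @ rev ws))"


section \<open>Geometric representations\<close>

text \<open>
  The vector space \<open>V\<close> is the type \<open>'v\<close>; \<open>\<Delta>\<close> is the image of \<open>S\<close> under \<open>a\<close>; and \<open>act\<close> is the
  action of \<open>W\<close> on \<open>V\<close>, determined by its values on \<open>S\<close>.
\<close>

locale geometric_representation = coxeter_system W S + faithful_action W "UNIV :: 'v set" act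
  for W :: "('g, 'm) monoid_scheme" (structure) and S
    and B :: "'v::real_vector \<Rightarrow> 'v \<Rightarrow> real"
    and a :: "'g \<Rightarrow> 'v"
    and act :: "'g \<Rightarrow> 'v \<Rightarrow> 'v" +
  assumes finite_dim: "\<exists>E :: 'v set. finite E \<and> span E = UNIV"
    and bilinear_form: "bilinear B"
    and symmetric_form: "\<And>u v. B u v = B v u"
    and positively_independent:
      "\<And>c. (\<And>s. s \<in> S \<Longrightarrow> 0 \<le> c s) \<Longrightarrow> (\<Sum>s\<in>S. c s *\<^sub>R a s) = 0 \<Longrightarrow> (\<And>s. s \<in> S \<Longrightarrow> c s = 0)"
    and form_diag: "\<And>s. s \<in> S \<Longrightarrow> B (a s) (a s) = 1"
    and form_finite: "\<And>s t. s \<in> S \<Longrightarrow> t \<in> S \<Longrightarrow> s \<noteq> t \<Longrightarrow> ord (s \<otimes> t) \<noteq> 0 \<Longrightarrow>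
      B (a s) (a t) = - cos (pi / real (ord (s \<otimes> t)))"
    and form_infinite: "\<And>s t. s \<in> S \<Longrightarrow> t \<in> S \<Longrightarrow> s \<noteq> t \<Longrightarrow> ord (s \<otimes> t) = 0 \<Longrightarrow>
      B (a s) (a t) \<le> -1"
    and act_gen: "\<And>s v. s \<in> S \<Longrightarrow> act s v = v - (2 * B (a s) v) *\<^sub>R a s"

definition roots :: "('g, 'm) monoid_scheme \<Rightarrow> 'g set \<Rightarrow> ('g \<Rightarrow> 'v) \<Rightarrow> ('g \<Rightarrow> 'v \<Rightarrow> 'v) \<Rightarrow> 'v set" where
  "roots W S a act = {act w (a s) | w s. w \<in> carrier W \<and> s \<in> S}"

definition pos_roots ::
    "('g, 'm) monoid_scheme \<Rightarrow> 'g set \<Rightarrow> ('g \<Rightarrow> 'v::real_vector) \<Rightarrow> ('g \<Rightarrow> 'v \<Rightarrow> 'v) \<Rightarrow> 'v set" where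
  "pos_roots W S a act = roots W S a act \<inter> (convex_cone hull (a ` S))"

definition neg_roots ::
    "('g, 'm) monoid_scheme \<Rightarrow> 'g set \<Rightarrow> ('g \<Rightarrow> 'v::real_vector) \<Rightarrow> ('g \<Rightarrow> 'v \<Rightarrow> 'v) \<Rightarrow> 'v set" where
  "neg_roots W S a act = uminus ` pos_roots W S a act"

text \<open>
  The reflection \<open>s\<^sub>\<beta>\<close> of a root, and the positive root \<open>\<alpha>\<^sub>t\<close> of a reflection.  The former is
  unique because the action is faithful.
\<close>

definition refl_of_root ::
    "('g, 'm) monoid_scheme \<Rightarrow> 'g set \<Rightarrow> ('v::real_vector \<Rightarrow> 'v \<Rightarrow> real) \<Rightarrow> ('g \<Rightarrow> 'v \<Rightarrow> 'v) \<Rightarrow> 'v \<Rightarrow> 'g"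
  where
  "refl_of_root W S B act \<beta> =
     (THE t. t \<in> reflections W S \<and> (\<forall>v. act t v = v - (2 * B \<beta> v) *\<^sub>R \<beta>))"

definition root_of_refl ::
    "('g, 'm) monoid_scheme \<Rightarrow> 'g set \<Rightarrow> ('v::real_vector \<Rightarrow> 'v \<Rightarrow> real) \<Rightarrow> ('g \<Rightarrow> 'v) \<Rightarrow>
     ('g \<Rightarrow> 'v \<Rightarrow> 'v) \<Rightarrow> 'g \<Rightarrow> 'v"
  where
  "root_of_refl W S B a act t =
     (THE \<alpha>. \<alpha> \<in> pos_roots W S a act \<and> refl_of_root W S B act \<alpha> = t)"

definition inversions ::
    "('g, 'm) monoid_scheme \<Rightarrow> 'g set \<Rightarrow> ('g \<Rightarrow> 'v::real_vector) \<Rightarrow> ('g \<Rightarrow> 'v \<Rightarrow> 'v) \<Rightarrow> 'g \<Rightarrow> 'v set"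
  where
  "inversions W S a act w =
     {\<alpha> \<in> pos_roots W S a act. act (inv\<^bsub>W\<^esub> w) \<alpha> \<in> neg_roots W S a act}"


section \<open>The dominance order\<close>

definition dominated_by ::
    "('g, 'm) monoid_scheme \<Rightarrow> 'g set \<Rightarrow> ('g \<Rightarrow> 'v::real_vector) \<Rightarrow> ('g \<Rightarrow> 'v \<Rightarrow> 'v) \<Rightarrow> 'v \<Rightarrow> 'v \<Rightarrow> bool"
  where
  "dominated_by W S a act \<alpha> \<beta> \<longleftrightarrow>
     (\<forall>w\<in>carrier W. \<beta> \<in> inversions W S a act w \<longrightarrow> \<alpha> \<in> inversions W S a act w)"

definition Dom ::
    "('g, 'm) monoid_scheme \<Rightarrow> 'g set \<Rightarrow> ('g \<Rightarrow> 'v::real_vector) \<Rightarrow> ('g \<Rightarrow> 'v \<Rightarrow> 'v) \<Rightarrow> 'v \<Rightarrow> 'v set"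
  where
  "Dom W S a act \<beta> = {\<alpha> \<in> pos_roots W S a act. dominated_by W S a act \<alpha> \<beta>}"

text \<open>
  Integer-valued on purpose.  \<open>card\<close> of an infinite set is \<open>0\<close>, so an infinite \<open>Dom\<close> would give
  \<open>-1\<close>; hence an equation of \<open>dp_inf\<close> with a cardinality also asserts that \<open>Dom\<close> is finite.
\<close>

definition dp_inf ::
    "('g, 'm) monoid_scheme \<Rightarrow> 'g set \<Rightarrow> ('g \<Rightarrow> 'v::real_vector) \<Rightarrow> ('g \<Rightarrow> 'v \<Rightarrow> 'v) \<Rightarrow> 'v \<Rightarrow> int"
  where
  "dp_inf W S a act \<beta> = int (card (Dom W S a act \<beta>)) - 1"

end

theory Submission
  imports Defs
begin

text \<open>
  Write \<open>p = q s\<close> for a reduced word of the prefix, so that \<open>t = q s q\<inverse>\<close> and \<open>\<beta> = q(\<alpha>\<^sub>s)\<close>.  For an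
  inversion \<open>\<alpha> \<noteq> \<beta>\<close> of \<open>p\<close>, both \<open>\<gamma> = q\<inverse>(\<beta>) = \<alpha>\<^sub>s\<close> and \<open>\<eta> = - q\<inverse>(\<alpha>)\<close> are positive roots, with
  \<open>B(\<gamma>, \<eta>) = - B(\<alpha>, \<beta>)\<close>, and \<open>\<alpha>\<close> fails to be dominated by \<open>\<beta>\<close> iff some \<open>v\<close> makes both \<open>\<gamma>\<close> and \<open>\<eta>\<close>
  negative.  As the word for \<open>t\<close> is reduced, \<open>\<alpha>\<close> is an inversion of \<open>t\<close> too, whence \<open>B(\<alpha>, \<beta>) > 0\<close>.
  If \<open>B(\<alpha>, \<beta>) \<ge> 1\<close>, then the cone of \<open>\<gamma>\<close> and \<open>\<eta>\<close> contains infinitely many roots, while inversion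
  sets are finite: there is no such \<open>v\<close>, and the two reflections generate an infinite group.  If
  \<open>0 < B(\<alpha>, \<beta>) < 1\<close>, then walking around the circle of the dihedral orbit produces \<open>v\<close>, and the
  finiteness of its inversion set forces the two reflections to generate a finite group.
\<close>

section \<open>Chebyshev recursion\<close>

text \<open>
  Chebyshev polynomials of the second kind, shifted by one: \<open>cheb (cos \<theta>) n = sin (n \<theta>) / sin \<theta>\<close>.
  They are the coordinates of the roots of a dihedral reflection group, both in the spherical case
  \<open>c < 1\<close> and in the infinite case \<open>c \<ge> 1\<close>.
\<close>
fun cheb :: "real \<Rightarrow> nat \<Rightarrow> real" where
  "cheb c 0 = 0"
| "cheb c (Suc 0) = 1"
| "cheb c (Suc (Suc n)) = 2 * c * cheb c (Suc n) - cheb c n"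

text \<open>For \<open>1 \<le> c\<close> the recursion never lets the increments shrink;
  nonnegativity is carried along so that \<open>c\<close> may be replaced by 1.\<close>

lemma cheb_strict_mono:
  assumes "1 \<le> c" shows "strict_mono (cheb c)"
proof -
  have "0 \<le> cheb c n \<and> cheb c n < cheb c (Suc n)" for n
  proof (induction n)
    case (Suc n)
    have "2 * cheb c (Suc n) \<le> 2 * c * cheb c (Suc n)"
      using Suc assms by (simp add: mult_le_cancel_right1)
    with Suc show ?case using cheb.simps(3)[of c n] by linarith
  qed simp
  then show ?thesis by (simp add: strict_mono_Suc_iff)
qed

lemma cheb_nonneg: "1 \<le> c \<Longrightarrow> 0 \<le> cheb c n"
  using strict_mono_leD[OF cheb_strict_mono, of c 0 n] by simp

lemma cheb_cos: "sin \<theta> * cheb (cos \<theta>) n = sin (real n * \<theta>)"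
proof (induction "cos \<theta>" n rule: cheb.induct)
  case (3 n)
  have "sin (real (Suc (Suc n)) * \<theta>) + sin (real n * \<theta>) = 2 * cos \<theta> * sin (real (Suc n) * \<theta>)"
    using sin_plus_sin[of "real (Suc (Suc n)) * \<theta>" "real n * \<theta>"]
    by (simp add: algebra_simps add_divide_distrib)
  with 3 show ?case by (simp add: algebra_simps)
qed auto

lemma cheb_cos_pi_nonneg:
  assumes "2 \<le> m" "n \<le> m" shows "0 \<le> cheb (cos (pi / real m)) n"
proof -
  have "0 < sin (pi / real m)"
    using assms by (intro sin_gt_zero) (auto simp: field_simps)
  moreover have "0 \<le> sin (real n * (pi / real m))"
    using assms by (intro sin_ge_zero) (auto simp: field_simps)
  ultimately show ?thesis
    unfolding cheb_cos[symmetric] by (simp add: zero_le_mult_iff)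
qed

lemma cheb_first_nonpos:
  assumes "0 \<le> c" "c < 1"
  obtains k where "2 \<le> k" "cheb c k \<le> 0" "\<And>j. 0 < j \<Longrightarrow> j < k \<Longrightarrow> 0 < cheb c j"
proof -
  define \<theta> where "\<theta> = arccos c"
  have c: "cos \<theta> = c" and th: "0 < \<theta>" "\<theta> \<le> pi / 2"
    using assms arccos_lt_bounded[of c] arccos_le_pi2[of c] by (auto simp: \<theta>_def)
  have "\<exists>k. 0 < k \<and> cheb c k \<le> 0"
  proof -
    \<comment> \<open>The first multiple of \<open>\<theta>\<close> at or past a half turn; it stays
      below \<open>pi + \<theta>\<close>, so its sine is nonpositive.\<close>
    define k where "k = nat \<lceil>pi / \<theta>\<rceil>"
    have 1: "pi / \<theta> \<le> real k" and 2: "real k < pi / \<theta> + 1"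
      using th by (simp_all add: k_def) linarith+
    have "pi \<le> real k * \<theta>" "real k * \<theta> < pi + \<theta>"
      using 1 2 th by (auto simp: field_simps)
    then have "sin (real k * \<theta>) \<le> 0" using th by (intro sin_le_zero) auto
    moreover have "0 < sin \<theta>" using th by (intro sin_gt_zero) auto
    ultimately have "cheb c k \<le> 0"
      using cheb_cos[of \<theta> k] c by (metis mult_pos_pos not_le)
    moreover have "0 < k" using 1 th by (cases k) (auto simp: field_simps)
    ultimately show ?thesis by blast
  qed
  then obtain k where k: "0 < k \<and> cheb c k \<le> 0" "\<And>j. j < k \<Longrightarrow> \<not> (0 < j \<and> cheb c j \<le> 0)"
    using exists_least_iff[of "\<lambda>k. 0 < k \<and> cheb c k \<le> 0"] by auto
  have "k \<noteq> 1" using k by auto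
  show ?thesis by (rule that[of k]) (use k \<open>k \<noteq> 1\<close> in \<open>auto simp: not_le\<close>)
qed

text \<open>Here and in the mirror image below: after a sign change the next term keeps the new
  sign, so sign changes are never adjacent.\<close>

lemma cheb_nonpos_Suc:
  assumes "0 \<le> c" "cheb c (Suc n) \<le> 0" "0 \<le> cheb c n" shows "cheb c (Suc (Suc n)) \<le> 0"
  using assms mult_nonneg_nonpos[of "2 * c" "cheb c (Suc n)"] by simp

lemma cheb_nonneg_Suc:
  assumes "0 \<le> c" "0 \<le> cheb c (Suc n)" "cheb c n \<le> 0" shows "0 \<le> cheb c (Suc (Suc n))"
  using assms mult_nonneg_nonneg[of "2 * c" "cheb c (Suc n)"] cheb.simps(3)[of c n] by linarith

section \<open>Groups generated by two involutions\<close>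

text \<open>The last (rightmost) of the \<open>n\<close> alternating factors is \<open>h\<close>.\<close>
fun alt_prod :: "('g, 'm) monoid_scheme \<Rightarrow> 'g \<Rightarrow> 'g \<Rightarrow> nat \<Rightarrow> 'g" where
  "alt_prod G g h 0 = \<one>\<^bsub>G\<^esub>"
| "alt_prod G g h (Suc n) = (if even n then h else g) \<otimes>\<^bsub>G\<^esub> alt_prod G g h n"

context group
begin

lemma alt_prod_closed [simp]:
  "g \<in> carrier G \<Longrightarrow> h \<in> carrier G \<Longrightarrow> alt_prod G g h n \<in> carrier G"
  by (induction n) auto

lemma alt_prod_Suc_right:
  "g \<in> carrier G \<Longrightarrow> h \<in> carrier G \<Longrightarrow> alt_prod G g h (Suc n) = alt_prod G h g n \<otimes> h"
  by (induction n) (auto simp: m_assoc)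

lemma alt_prod_even:
  "g \<in> carrier G \<Longrightarrow> h \<in> carrier G \<Longrightarrow> alt_prod G g h (2 * n) = (g \<otimes> h) [^] n"
proof (induction n)
  case (Suc n)
  then have "alt_prod G g h (2 * Suc n) = (g \<otimes> h) \<otimes> (g \<otimes> h) [^] n"
    by (simp add: m_assoc)
  also have "\<dots> = (g \<otimes> h) [^] Suc n"
    using Suc by (metis m_closed nat_pow_Suc2)
  finally show ?case .
qed simp

lemma alt_prod_in_generate:
  "alt_prod G g h n \<in> generate G {g, h}"
  by (induction n) (auto intro: generate.intros)

text \<open>For \<open>m = 2 * n\<close> the power \<open>x = (g \<otimes> h) [^] n\<close> is its
  own inverse. For \<open>m = 2 * n + 1\<close> the product \<open>x g h x\<close> is trivial,
  whence \<open>h \<otimes> x = g \<otimes> inv x\<close>.\<close>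

lemma alt_prod_braid:
  assumes "g \<in> carrier G" "h \<in> carrier G" "g \<otimes> g = \<one>" "h \<otimes> h = \<one>"
    and "(g \<otimes> h) [^] (m :: nat) = \<one>"
  shows "alt_prod G g h m = alt_prod G h g m"
proof -
  have inv: "inv g = g" "inv h = h" using assms by (auto intro: inv_equality)
  have pow: "(h \<otimes> g) [^] n = inv ((g \<otimes> h) [^] n)" for n :: nat
  proof -
    have "h \<otimes> g = inv (g \<otimes> h)" using assms inv by (simp add: inv_mult_group)
    then show ?thesis using assms by (simp add: nat_pow_inv)
  qed
  have cl: "(g \<otimes> h) [^] n \<in> carrier G" for n :: nat using assms by simp
  show ?thesis
  proof (cases "even m")
    case True
    then obtain n where m: "m = 2 * n" by auto
    have "(g \<otimes> h) [^] n \<otimes> (g \<otimes> h) [^] n = \<one>"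
      using assms by (simp add: nat_pow_mult m mult_2)
    then have "(g \<otimes> h) [^] n = inv ((g \<otimes> h) [^] n)"
      using inv_equality[of "(g \<otimes> h) [^] n" "(g \<otimes> h) [^] n"] cl by simp
    then show ?thesis using assms by (simp only: m alt_prod_even pow)
  next
    case False
    then obtain n where m: "m = Suc (2 * n)" by (auto elim: oddE)
    define x where "x = (g \<otimes> h) [^] n"
    have x: "x \<in> carrier G" using cl by (simp add: x_def)
    have "(g \<otimes> h) [^] m = (g \<otimes> h) [^] Suc n \<otimes> (g \<otimes> h) [^] n"
      using nat_pow_mult[of "g \<otimes> h" "Suc n" n] assms(1,2) by (simp only: m m_closed) (simp add: mult_2)
    then have "x \<otimes> (g \<otimes> h) \<otimes> x = \<one>"
      using assms(5) by (simp add: x_def)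
    then have "(g \<otimes> (h \<otimes> x)) \<otimes> x = \<one>"
      using assms(1,2) x inv_comm[of x "g \<otimes> (h \<otimes> x)"] by (simp add: m_assoc)
    then have "inv x = g \<otimes> (h \<otimes> x)"
      using assms(1,2) x by (intro inv_equality) auto
    then have "g \<otimes> inv x = (g \<otimes> g) \<otimes> (h \<otimes> x)"
      using assms(1,2) x by (simp add: m_assoc)
    then have "h \<otimes> x = g \<otimes> inv x"
      using assms(2,3) x by simp
    then show ?thesis using assms by (simp add: m alt_prod_even pow x_def)
  qed
qed

lemma generate_subset_if_left_closed:
  assumes "A \<subseteq> carrier G" "K \<subseteq> carrier G" "\<one> \<in> K"
    and "\<And>x y. x \<in> A \<Longrightarrow> y \<in> K \<Longrightarrow> x \<otimes> y \<in> K \<and> inv x \<otimes> y \<in> K"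
  shows "generate G A \<subseteq> K"
proof
  fix x assume x: "x \<in> generate G A"
  \<comment> \<open>Left multiplication by \<open>x\<close> preserving \<open>K\<close> is a
    property closed under products; at \<open>\<one>\<close> it yields
    \<open>x \<in> K\<close>.\<close>
  then have "\<forall>y\<in>K. x \<otimes> y \<in> K"
  proof (induction rule: generate.induct)
    case (eng x z)
    then show ?case
      using assms generate_in_carrier[OF assms(1)] by (auto simp: m_assoc subset_iff)
  qed (use assms in \<open>auto simp: subset_iff\<close>)
  then show "x \<in> K" using assms generate_in_carrier[OF assms(1) x] by force
qed

text \<open>Dihedral normal form: conjugation by \<open>g\<close> inverts
  \<open>r = g \<otimes> h\<close>, so the cyclic group \<open>C\<close> of \<open>r\<close> and its
  coset \<open>C g\<close> together absorb \<open>g\<close> and \<open>h\<close> from the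
  left.\<close>

lemma finite_generate_involutions:
  assumes "g \<in> carrier G" "h \<in> carrier G" "g \<otimes> g = \<one>" "h \<otimes> h = \<one>" "ord (g \<otimes> h) \<noteq> 0"
  shows "finite (generate G {g, h})"
proof -
  define r where "r = g \<otimes> h"
  define C where "C = generate G {r}"
  have r: "r \<in> carrier G" using assms by (simp add: r_def)
  have inv: "inv g = g" "inv h = h" using assms by (auto intro: inv_equality)
  interpret C: subgroup C G unfolding C_def using r by (intro generate_is_subgroup) auto
  have g_cancel: "g \<otimes> (g \<otimes> x) = x" if "x \<in> carrier G" for x
    using that assms by (metis l_one m_assoc)
  have "finite C"
    using generate_pow_card[OF r] assms(5) unfolding C_def r_def by (metis card.infinite)
  have conj: "g \<otimes> x \<otimes> g \<in> C" if x: "x \<in> C" for x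
  proof -
    obtain k :: nat where k: "x = r [^] k"
      using x generate_pow_nat[OF r] assms(5) unfolding C_def r_def by auto
    have "inv r = g \<otimes> r \<otimes> g"
      using assms inv g_cancel by (simp add: r_def inv_mult_group m_assoc)
    have "g \<otimes> r [^] k \<otimes> g = inv r [^] k"
    proof (induction k)
      case (Suc k)
      have "g \<otimes> r [^] Suc k \<otimes> g = (g \<otimes> r [^] k \<otimes> g) \<otimes> (g \<otimes> r \<otimes> g)"
        using assms r g_cancel by (simp add: m_assoc)
      with Suc \<open>inv r = g \<otimes> r \<otimes> g\<close> show ?case by simp
    qed (use assms in simp)
    then have "g \<otimes> x \<otimes> g = inv x" using r by (simp add: k nat_pow_inv)
    then show ?thesis using x by simp
  qed
  define K where "K = C \<union> (\<lambda>c. c \<otimes> g) ` C"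
  have K: "K \<subseteq> carrier G" using assms C.subset by (auto simp: K_def)
  have g_K: "g \<otimes> y \<in> K" if "y \<in> K" for y
  proof (cases "y \<in> C")
    case True
    then have "g \<otimes> y = (g \<otimes> y \<otimes> g) \<otimes> g"
      using assms by (simp add: m_assoc)
    with conj[OF True] show ?thesis unfolding K_def by blast
  next
    case False
    with that conj assms show ?thesis by (auto simp: K_def simp flip: m_assoc)
  qed
  have C_K: "c \<otimes> y \<in> K" if "c \<in> C" "y \<in> K" for c y
    using that assms by (auto simp: K_def simp flip: m_assoc)
  have "inv r \<in> C" by (simp add: C_def generate.inv)
  have h: "h = inv r \<otimes> g" using assms inv by (simp add: r_def inv_mult_group m_assoc)
  have h_K: "h \<otimes> y \<in> K" if "y \<in> K" for y
  proof -
    have "h \<otimes> y = inv r \<otimes> (g \<otimes> y)" using h assms that K r by (metis inv_closed m_assoc subsetD)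
    then show ?thesis using C_K[OF \<open>inv r \<in> C\<close> g_K[OF that]] by simp
  qed
  have "\<one> \<in> K" by (simp add: K_def)
  then have "generate G {g, h} \<subseteq> K"
    by (intro generate_subset_if_left_closed) (use assms(1,2) K g_K h_K inv in auto)
  moreover have "finite K" using \<open>finite C\<close> by (simp add: K_def)
  ultimately show ?thesis by (rule finite_subset)
qed

text \<open>At fixed parity the conjugate determines \<open>(g \<otimes> h) [^] n\<close>, so a
  repeated reflection will give a repeated power.\<close>

lemma alt_prod_conj:
  assumes "g \<in> carrier G" "h \<in> carrier G" "g \<otimes> g = \<one>" "h \<otimes> h = \<one>"
  shows "alt_prod G g h n \<otimes> g \<otimes> inv (alt_prod G g h n) =
    (if even n then (g \<otimes> h) [^] n \<otimes> g else h \<otimes> (g \<otimes> h) [^] n)"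
proof (induction n)
  case (Suc n)
  define z where "z = (if even n then h else g)"
  have z: "z \<in> carrier G" "inv z = z"
    using assms by (auto simp: z_def intro: inv_equality)
  have "alt_prod G g h (Suc n) \<otimes> g \<otimes> inv (alt_prod G g h (Suc n)) =
      z \<otimes> (alt_prod G g h n \<otimes> g \<otimes> inv (alt_prod G g h n)) \<otimes> z"
    using assms z by (simp add: z_def[symmetric] inv_mult_group m_assoc)
  also have "\<dots> = (if even (Suc n) then (g \<otimes> h) [^] Suc n \<otimes> g else h \<otimes> (g \<otimes> h) [^] Suc n)"
  proof (cases "even n")
    case True
    then show ?thesis using assms unfolding Suc by (simp add: z_def m_assoc)
  next
    case False
    have "(g \<otimes> h) [^] Suc n = (g \<otimes> h) \<otimes> (g \<otimes> h) [^] n"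
      using assms by (intro nat_pow_Suc2) simp
    with False show ?thesis using assms unfolding Suc by (simp add: z_def m_assoc del: nat_pow_Suc)
  qed
  finally show ?case .
qed (use assms in simp)

end

section \<open>Words and length\<close>

lemma word_prod_Nil [simp]: "word_prod W [] = \<one>\<^bsub>W\<^esub>"
  and word_prod_Cons [simp]: "word_prod W (x # xs) = x \<otimes>\<^bsub>W\<^esub> word_prod W xs"
  by (simp_all add: word_prod_def)

context coxeter_system
begin

lemma reduced_word_for_iff:
  "reduced_word_for W S w ws \<longleftrightarrow> set ws \<subseteq> S \<and> word_prod W ws = w \<and> length ws = cox_length W S w"
  by (simp add: reduced_word_for_def lists_eq_set)

abbreviation len :: "'g \<Rightarrow> nat" where "len \<equiv> cox_length W S"

lemma gen_carrier [simp]: "s \<in> S \<Longrightarrow> s \<in> carrier W"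
  using gens_closed by auto

lemma gen_square [simp]: "s \<in> S \<Longrightarrow> s \<otimes> s = \<one>"
  using gens_order[of s] pow_ord_eq_1[of s] by (simp add: numeral_2_eq_2)

lemma gen_inv [simp]: "s \<in> S \<Longrightarrow> inv s = s"
  by (intro inv_equality) auto

lemma word_prod_closed [simp]: "set ws \<subseteq> S \<Longrightarrow> word_prod W ws \<in> carrier W"
  by (induction ws) auto

lemma word_prod_append:
  "set us \<subseteq> S \<Longrightarrow> set vs \<subseteq> S \<Longrightarrow> word_prod W (us @ vs) = word_prod W us \<otimes> word_prod W vs"
  by (induction us) (auto simp: m_assoc)

lemma word_prod_rev: "set ws \<subseteq> S \<Longrightarrow> word_prod W (rev ws) = inv (word_prod W ws)"
  by (induction ws) (auto simp: word_prod_append inv_mult_group)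

lemma word_exists:
  assumes "w \<in> carrier W" shows "\<exists>ws. set ws \<subseteq> S \<and> word_prod W ws = w"
proof -
  have "w \<in> generate W S" using assms gens_generate by simp
  then show ?thesis
  proof (induction rule: generate.induct)
    case one show ?case by (rule exI[of _ "[]"]) auto
  next
    case (incl s) then show ?case by (intro exI[of _ "[s]"]) auto
  next
    case (inv s) then show ?case by (intro exI[of _ "[s]"]) auto
  next
    case (eng x y)
    then obtain us vs where "set us \<subseteq> S" "word_prod W us = x" "set vs \<subseteq> S" "word_prod W vs = y"
      by blast
    then show ?case by (intro exI[of _ "us @ vs"]) (auto simp: word_prod_append)
  qed
qed

lemma reduced_word_exists:
  assumes "w \<in> carrier W" obtains ws where "reduced_word_for W S w ws"
proof -
  have "\<exists>n. \<exists>ws\<in>lists S. word_prod W ws = w \<and> length ws = n"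
    using word_exists[OF assms] by (auto simp: lists_eq_set)
  from LeastI_ex[OF this] show ?thesis
    using that unfolding reduced_word_for_def cox_length_def by blast
qed

lemma len_word_prod_le: "set ws \<subseteq> S \<Longrightarrow> len (word_prod W ws) \<le> length ws"
  unfolding cox_length_def by (rule Least_le) (auto simp: lists_eq_set)

lemma len_one [simp]: "len \<one> = 0"
  using len_word_prod_le[of "[]"] by simp

lemma len_gen_le: "s \<in> S \<Longrightarrow> len s \<le> 1"
  using len_word_prod_le[of "[s]"] by simp

lemma len_mult_le:
  assumes "x \<in> carrier W" "y \<in> carrier W" shows "len (x \<otimes> y) \<le> len x + len y"
proof -
  obtain us vs where "reduced_word_for W S x us" "reduced_word_for W S y vs"
    using assms reduced_word_exists by metis
  then show ?thesis
    using len_word_prod_le[of "us @ vs"] by (auto simp: reduced_word_for_iff word_prod_append)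
qed

text \<open>Relators have even length, so relator steps keep the parity of the word length. This is
  where \<open>presentation\<close> enters.\<close>

lemma even_length_trivial_word:
  assumes "set ws \<subseteq> S" "word_prod W ws = \<one>" shows "even (length ws)"
proof -
  have l: "ws \<in> lists S" using assms by (simp add: lists_eq_set)
  have step: "even (length us) = even (length vs)" if "relator_step W S us vs" for us vs
    using that by (auto simp: relator_step_def length_concat sum_list_replicate)
  have "even (length us) = even (length vs)" if "equivclp (relator_step W S) us vs" for us vs
    using that by (induction rule: equivclp_induct) (auto dest: step)
  from this[OF presentation[OF l assms(2)]] show ?thesis by simp
qed

text \<open>Equal lengths would give a trivial word of odd length: a reduced word of
  \<open>w\<close>, then \<open>s\<close>, then a reversed reduced word of
  \<open>w \<otimes> s\<close>.\<close>

lemma len_mult_gen_neq: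
  assumes "w \<in> carrier W" "s \<in> S" shows "len (w \<otimes> s) \<noteq> len w"
proof -
  obtain us vs where r: "reduced_word_for W S w us" "reduced_word_for W S (w \<otimes> s) vs"
    using assms reduced_word_exists by (metis gen_carrier m_closed)
  then have "even (length (us @ s # rev vs))"
    using assms
    by (intro even_length_trivial_word)
      (auto simp: reduced_word_for_iff word_prod_append word_prod_rev simp flip: m_assoc)
  with r show ?thesis by (auto simp: reduced_word_for_iff)
qed

lemma mult_gen_gen [simp]: "w \<in> carrier W \<Longrightarrow> s \<in> S \<Longrightarrow> w \<otimes> s \<otimes> s = w"
  by (simp add: m_assoc)

lemma len_mult_gen_cases:
  assumes "w \<in> carrier W" "s \<in> S"
  shows "len (w \<otimes> s) = Suc (len w) \<or> len w = Suc (len (w \<otimes> s))"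
proof -
  have "len (w \<otimes> s) \<le> len w + 1" "len (w \<otimes> s \<otimes> s) \<le> len (w \<otimes> s) + 1"
    using assms len_mult_le[of w s] len_mult_le[of "w \<otimes> s" s] len_gen_le[of s] by auto
  with len_mult_gen_neq[OF assms] assms show ?thesis by simp linarith
qed

lemma reduced_word_prefix:
  assumes "reduced_word_for W S w (us @ vs)"
  shows "reduced_word_for W S (word_prod W us) us"
proof -
  have l: "set us \<subseteq> S" "set vs \<subseteq> S" and w: "w = word_prod W us \<otimes> word_prod W vs"
    and len: "len w = length us + length vs"
    using assms by (auto simp: reduced_word_for_iff word_prod_append)
  have "len w \<le> len (word_prod W us) + length vs"
    using len_mult_le[of "word_prod W us" "word_prod W vs"] len_word_prod_le[of vs] l w by simp
  then show ?thesis
    using len l len_word_prod_le[of us] by (simp add: reduced_word_for_iff)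
qed

lemma len_mult_inv_alt_prod:
  assumes "w \<in> carrier W" "s \<in> S" "t \<in> S"
  shows "len w \<le> len (w \<otimes> inv (alt_prod W s t n)) + n"
proof (induction n)
  case (Suc n)
  let ?x = "if even n then t else s"
  have x: "?x \<in> S" using assms by simp
  have "w \<otimes> inv (alt_prod W s t (Suc n)) = w \<otimes> inv (alt_prod W s t n) \<otimes> ?x"
    using assms by (auto simp: inv_mult_group m_assoc)
  moreover have "len (w \<otimes> inv (alt_prod W s t n)) \<le> Suc (len (w \<otimes> inv (alt_prod W s t n) \<otimes> ?x))"
    using len_mult_gen_cases[of "w \<otimes> inv (alt_prod W s t n)" ?x] assms x by auto
  ultimately show ?case using Suc by simp
qed (use assms in auto)

lemma len_alt_prod_le: "s \<in> S \<Longrightarrow> t \<in> S \<Longrightarrow> len (alt_prod W s t n) \<le> n"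
proof (induction n)
  case (Suc n)
  have "len (alt_prod W s t (Suc n)) \<le> len (if even n then t else s) + len (alt_prod W s t n)"
    using Suc.prems len_mult_le by simp
  then show ?case using Suc len_gen_le[of s] len_gen_le[of t] by (auto split: if_splits)
qed simp

text \<open>At length \<open>ord (s \<otimes> t)\<close> the braid relation rewrites the product to
  end in \<open>s\<close>, which cancels; each further letter on the left adds at most one.\<close>

lemma len_alt_prod_mult_gen:
  assumes "s \<in> S" "t \<in> S" "ord (s \<otimes> t) \<noteq> 0" "ord (s \<otimes> t) \<le> n"
  shows "len (alt_prod W s t n \<otimes> s) < n"
  using assms(4)
proof (induction n rule: dec_induct)
  case base
  obtain k where k: "ord (s \<otimes> t) = Suc k" using assms(3) not0_implies_Suc by blast
  have "alt_prod W s t (Suc k) = alt_prod W t s (Suc k)"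
    using assms(1,2) by (intro alt_prod_braid) (auto simp flip: k)
  then have "alt_prod W s t (Suc k) \<otimes> s = alt_prod W s t k"
    using assms(1,2) alt_prod_Suc_right[of t s k] by simp
  then show ?case using len_alt_prod_le[of s t k] assms k by simp
next
  case (step n)
  have "len (alt_prod W s t (Suc n) \<otimes> s) \<le>
      len (if even n then t else s) + len (alt_prod W s t n \<otimes> s)"
    using assms len_mult_le[of "if even n then t else s" "alt_prod W s t n \<otimes> s"]
    by (simp add: m_assoc split: if_splits)
  then show ?case using step assms len_gen_le[of s] len_gen_le[of t] by (auto split: if_splits)
qed

end

section \<open>Positivity of roots\<close>

context geometric_representation
begin

abbreviation "\<Phi> \<equiv> roots W S a act"
abbreviation "\<Phi>\<^sub>p \<equiv> pos_roots W S a act"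
abbreviation "\<Phi>\<^sub>n \<equiv> neg_roots W S a act"
abbreviation "N \<equiv> inversions W S a act"
abbreviation "cone\<^sub>\<Delta> \<equiv> convex_cone hull (a ` S)"

section \<open>The invariant form, the cone of simple roots, reflections\<close>

lemmas form_simps = bilinear_ladd[OF bilinear_form] bilinear_radd[OF bilinear_form]
  bilinear_lsub[OF bilinear_form] bilinear_rsub[OF bilinear_form]
  bilinear_lneg[OF bilinear_form] bilinear_rneg[OF bilinear_form]
  bilinear_lmul[OF bilinear_form] bilinear_rmul[OF bilinear_form]
  bilinear_lzero[OF bilinear_form] bilinear_rzero[OF bilinear_form]

lemma form_sum_right: "B u (\<Sum>s\<in>A. c s *\<^sub>R f s) = (\<Sum>s\<in>A. c s * B u (f s))"
  by (induction A rule: infinite_finite_induct) (auto simp: form_simps)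

lemma act_one [simp]: "act \<one> v = v"
  using id_eq_one by (metis UNIV_I restrict_apply')

lemma act_mult: "x \<in> carrier W \<Longrightarrow> y \<in> carrier W \<Longrightarrow> act (x \<otimes> y) v = act x (act y v)"
  by (rule composition_rule) auto

lemma act_inv_cancel [simp]: "w \<in> carrier W \<Longrightarrow> act (inv w) (act w v) = v"
  and act_cancel_inv [simp]: "w \<in> carrier W \<Longrightarrow> act w (act (inv w) v) = v"
  by (simp_all flip: act_mult)

lemma act_eqI: "x \<in> carrier W \<Longrightarrow> y \<in> carrier W \<Longrightarrow> (\<And>v. act x v = act y v) \<Longrightarrow> x = y"
  using faithful by (meson ext inj_onD)

lemma carrier_induct [consumes 1, case_names one mult]:
  assumes "w \<in> carrier W" "P \<one>"
    and "\<And>s w. s \<in> S \<Longrightarrow> w \<in> carrier W \<Longrightarrow> P w \<Longrightarrow> P (s \<otimes> w)"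
  shows "P w"
proof -
  have "P (word_prod W ws)" if "set ws \<subseteq> S" for ws
    using that by (induction ws) (auto intro: assms)
  then show ?thesis using word_exists[OF assms(1)] by blast
qed

lemma linear_act: "w \<in> carrier W \<Longrightarrow> linear (act w)"
proof (induction rule: carrier_induct)
  case one
  show ?case by (auto intro!: linearI)
next
  case (mult s w)
  interpret linear "act w" by (rule mult)
  show ?case
    using mult
    by (intro linearI)
      (simp_all add: act_mult act_gen add scale form_simps algebra_simps scaleR_add_left)
qed

lemmas act_simps = linear_add[OF linear_act] linear_diff[OF linear_act] linear_neg[OF linear_act]
  linear_cmul[OF linear_act] linear_0[OF linear_act]

lemma form_act: "w \<in> carrier W \<Longrightarrow> B (act w u) (act w v) = B u v"
proof (induction rule: carrier_induct)
  case (mult s w)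
  then show ?case
    by (simp add: act_mult act_gen form_simps form_diag symmetric_form[of "act w u" "a s"] algebra_simps)
qed simp

lemma cone_coeffs:
  assumes "x \<in> cone\<^sub>\<Delta>"
  obtains c where "\<And>s. 0 \<le> c s" "x = (\<Sum>s\<in>S. c s *\<^sub>R a s)"
proof -
  let ?K = "{x. \<exists>c. (\<forall>s. 0 \<le> c s) \<and> x = (\<Sum>s\<in>S. c s *\<^sub>R a s)}"
  have "cone\<^sub>\<Delta> \<subseteq> ?K"
  proof (rule hull_minimal)
    show "a ` S \<subseteq> ?K"
    proof clarify
      fix r assume "r \<in> S"
      then have "a r = (\<Sum>s\<in>S. (if s = r then 1 else 0) *\<^sub>R a s)"
        using finite_gens by (simp add: if_distrib[of "\<lambda>x. x *\<^sub>R _"] cong: if_cong)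
      then show "\<exists>c. (\<forall>s. 0 \<le> c s) \<and> a r = (\<Sum>s\<in>S. c s *\<^sub>R a s)"
        by (intro exI[of _ "\<lambda>s. if s = r then 1 else 0"]) auto
    qed
    show "convex_cone ?K"
      unfolding convex_cone_iff
    proof (intro conjI ballI allI impI)
      show "0 \<in> ?K" by (auto intro!: exI[of _ "\<lambda>_. 0"])
    next
      fix x y assume "x \<in> ?K" "y \<in> ?K"
      then obtain c d where "\<And>s. 0 \<le> c s" "x = (\<Sum>s\<in>S. c s *\<^sub>R a s)"
        "\<And>s. 0 \<le> d s" "y = (\<Sum>s\<in>S. d s *\<^sub>R a s)"
        by auto
      then show "x + y \<in> ?K"
        by (auto intro!: exI[of _ "\<lambda>s. c s + d s"] simp: scaleR_add_left sum.distrib)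
    next
      fix x and k :: real assume "x \<in> ?K" "0 \<le> k"
      then obtain c where "\<And>s. 0 \<le> c s" "x = (\<Sum>s\<in>S. c s *\<^sub>R a s)" by auto
      with \<open>0 \<le> k\<close> show "k *\<^sub>R x \<in> ?K"
        by (auto intro!: exI[of _ "\<lambda>s. k * c s"] simp: scaleR_sum_right)
    qed
  qed
  with assms that show ?thesis by auto
qed

lemma simple_in_cone: "s \<in> S \<Longrightarrow> a s \<in> cone\<^sub>\<Delta>"
  by (auto intro: hull_inc)

lemma cone_comb:
  "x \<in> cone\<^sub>\<Delta> \<Longrightarrow> y \<in> cone\<^sub>\<Delta> \<Longrightarrow> 0 \<le> c \<Longrightarrow> 0 \<le> d \<Longrightarrow> c *\<^sub>R x + d *\<^sub>R y \<in> cone\<^sub>\<Delta>"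
  by (intro convex_cone_hull_add convex_cone_hull_mul)

text \<open>Positive independence, applied to the summed coefficients of \<open>x\<close> and
  \<open>- x\<close>, stands in for linear independence.\<close>

lemma cone_pointed:
  assumes "x \<in> cone\<^sub>\<Delta>" "- x \<in> cone\<^sub>\<Delta>" shows "x = 0"
proof -
  obtain c d where c: "\<And>s. 0 \<le> c s" "x = (\<Sum>s\<in>S. c s *\<^sub>R a s)"
    and d: "\<And>s. 0 \<le> d s" "- x = (\<Sum>s\<in>S. d s *\<^sub>R a s)"
    using assms by (metis cone_coeffs)
  have "(\<Sum>s\<in>S. (c s + d s) *\<^sub>R a s) = 0"
    unfolding scaleR_add_left sum.distrib c(2)[symmetric] d(2)[symmetric] by simp
  then have cd: "c s + d s = 0" if "s \<in> S" for s
    using positively_independent[of "\<lambda>s. c s + d s" s] that c d by simp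
  have "c s = 0" if "s \<in> S" for s
    using cd[OF that] c(1)[of s] d(1)[of s] by linarith
  with c(2) show ?thesis by simp
qed

lemma form_simple_nonpos:
  assumes "s \<in> S" "t \<in> S" "s \<noteq> t" shows "B (a s) (a t) \<le> 0"
proof (cases "ord (s \<otimes> t) = 0")
  case False
  have "ord (s \<otimes> t) \<noteq> 1"
    using assms ord_eq_1[of "s \<otimes> t"] by (metis gen_carrier gen_inv inv_equality m_closed)
  with False have "0 \<le> cos (pi / real (ord (s \<otimes> t)))"
    by (intro cos_ge_zero) (auto simp: field_simps intro: order_trans[of _ 0])
  with form_finite[OF assms False] show ?thesis by simp
qed (use form_infinite[OF assms] in auto)

text \<open>A relation, so that \<open>\<gamma>\<close> and \<open>- \<gamma>\<close> share the same
  \<open>g\<close>; no positivity is built in, which later allows pairs such as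
  \<open>\<beta>\<close> and \<open>- \<alpha>\<close>.\<close>

definition reflects :: "'g \<Rightarrow> 'v \<Rightarrow> bool" where
  "reflects g \<gamma> \<longleftrightarrow> g \<in> carrier W \<and> B \<gamma> \<gamma> = 1 \<and> (\<forall>v. act g v = v - (2 * B \<gamma> v) *\<^sub>R \<gamma>)"

lemma reflectsD:
  assumes "reflects g \<gamma>"
  shows "g \<in> carrier W" "B \<gamma> \<gamma> = 1" "act g v = v - (2 * B \<gamma> v) *\<^sub>R \<gamma>" "act g \<gamma> = - \<gamma>"
  using assms by (auto simp: reflects_def scaleR_2)

lemma reflects_gen: "s \<in> S \<Longrightarrow> reflects s (a s)"
  by (simp add: reflects_def form_diag act_gen)

lemma reflects_uminus: "reflects g \<gamma> \<Longrightarrow> reflects g (- \<gamma>)"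
  by (simp add: reflects_def form_simps)

lemma reflects_conj:
  assumes "reflects g \<gamma>" "u \<in> carrier W" shows "reflects (u \<otimes> g \<otimes> inv u) (act u \<gamma>)"
proof -
  have "B \<gamma> (act (inv u) v) = B (act u \<gamma>) v" for v
    using form_act[of u \<gamma> "act (inv u) v"] assms by simp
  then show ?thesis
    using assms by (auto simp: reflects_def act_mult act_simps form_act)
qed

lemma reflects_unique: "reflects g \<gamma> \<Longrightarrow> reflects h \<gamma> \<Longrightarrow> g = h"
  by (rule act_eqI) (auto simp: reflects_def)

text \<open>Evaluating both formulas at \<open>\<gamma>\<close> makes it a multiple of
  \<open>\<delta>\<close>; as both have norm 1, the factor is 1 or -1.\<close>

lemma reflects_same_root:
  assumes "reflects g \<gamma>" "reflects g \<delta>" shows "\<delta> = \<gamma> \<or> \<delta> = - \<gamma>"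
proof -
  have "2 *\<^sub>R \<gamma> = \<gamma> - act g \<gamma>"
    using reflectsD(4)[OF assms(1)] by (simp add: scaleR_2)
  also have "\<dots> = 2 *\<^sub>R (B \<delta> \<gamma> *\<^sub>R \<delta>)"
    using reflectsD(3)[OF assms(2)] by simp
  finally have "2 *\<^sub>R \<gamma> = 2 *\<^sub>R (B \<delta> \<gamma> *\<^sub>R \<delta>)" .
  then have eq: "\<gamma> = B \<delta> \<gamma> *\<^sub>R \<delta>" by (metis scaleR_cancel_left zero_neq_numeral)
  have "B \<gamma> \<gamma> = B \<delta> \<gamma> * B \<delta> \<gamma>"
    by (subst eq) (simp add: form_simps)
  then have "B \<delta> \<gamma> = 1 \<or> B \<delta> \<gamma> = -1"
    using reflectsD(2)[OF assms(1)] square_eq_1_iff by metis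
  with eq show ?thesis by (metis minus_minus scaleR_minus1_left scaleR_one)
qed

text \<open>Each reflection changes only the coefficient of its own vector, from \<open>x\<close> to
  \<open>2 * c * y - x\<close> with \<open>y\<close> the other coefficient: the Chebyshev
  recursion.\<close>

lemma act_alt_prod:
  assumes "reflects g \<gamma>" "reflects h \<eta>" "B \<gamma> \<eta> = - c"
  shows "act (alt_prod W g h n) \<gamma> =
    (if even n then cheb c (Suc n) *\<^sub>R \<gamma> + cheb c n *\<^sub>R \<eta>
     else cheb c n *\<^sub>R \<gamma> + cheb c (Suc n) *\<^sub>R \<eta>)"
proof (induction n)
  case (Suc n)
  note r = reflectsD[OF assms(1)] reflectsD[OF assms(2)]
  have "B \<eta> \<gamma> = - c" using assms(3) symmetric_form by simp
  with assms(3) show ?case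
    by (simp add: act_mult Suc r(1,5)) (simp add: r form_simps algebra_simps flip: scaleR_2)
qed simp

text \<open>
  Strip from \<open>w\<close> the longest possible suffix alternating in \<open>s\<close> and a right descent \<open>t\<close>.  What remains
  has neither \<open>s\<close> nor \<open>t\<close> as a right descent, so induction applies to it, and the suffix acts on
  \<open>a s\<close> by nonnegative Chebyshev coefficients.
\<close>
lemma act_simple_in_cone:
  assumes "w \<in> carrier W" "s \<in> S" "len w < len (w \<otimes> s)"
  shows "act w (a s) \<in> cone\<^sub>\<Delta>"
  using assms
proof (induction "len w" arbitrary: w s rule: less_induct)
  case less
  note w = \<open>w \<in> carrier W\<close> and s = \<open>s \<in> S\<close>
  obtain ws where ws: "reduced_word_for W S w ws" using reduced_word_exists[OF w] .
  show ?case
  proof (cases ws rule: rev_cases)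
    case Nil
    with ws s show ?thesis by (auto simp: reduced_word_for_iff simple_in_cone)
  next
    case (snoc us t)
    have us: "set us \<subseteq> S" "len (word_prod W us) = length us" and t: "t \<in> S"
      and wt: "w = word_prod W us \<otimes> t" "len w = Suc (length us)"
      using ws reduced_word_prefix[of w us "[t]"]
      by (auto simp: reduced_word_for_iff snoc word_prod_append)
    have "s \<noteq> t" using less.prems us t wt by auto
    \<comment> \<open>\<open>P n\<close>: stripping \<open>n\<close> alternating letters from the
      right, \<open>t\<close> first, lowers the length by the full \<open>n\<close>.\<close>
    define P where "P n \<longleftrightarrow> len w = len (w \<otimes> inv (alt_prod W s t n)) + n" for n
    define n where "n = (GREATEST n. P n)"
    have bound: "\<And>n. P n \<Longrightarrow> n \<le> len w" by (simp add: P_def)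
    have "P 1" using us t wt by (simp add: P_def)
    then have "P n" "1 \<le> n"
      unfolding n_def by (blast intro: GreatestI_nat Greatest_le_nat bound)+
    have "\<not> P (Suc n)"
      using Greatest_le_nat[of P "Suc n" "len w"] bound unfolding n_def by fastforce
    define A where "A = alt_prod W s t n"
    define v where "v = w \<otimes> inv A"
    have A: "A \<in> carrier W" and v: "v \<in> carrier W" using w s t by (simp_all add: A_def v_def)
    have w_eq: "w = v \<otimes> A" using w A by (simp add: v_def m_assoc)
    have len_w: "len w = len v + n" using \<open>P n\<close> by (simp add: P_def v_def A_def)
    have asc: "len v < len (v \<otimes> r)" if "r \<in> {s, t}" for r
    \<comment> \<open>Either \<open>r\<close> is the next letter to strip, where a drop contradicts
      maximality of \<open>n\<close>, or it was stripped last, and restoring it leaves only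
      \<open>n - 1\<close> letters removed.\<close>
    proof (cases "r = (if even n then t else s)")
      case True
      then have "v \<otimes> r = w \<otimes> inv (alt_prod W s t (Suc n))"
        using w s t by (auto simp: v_def A_def inv_mult_group m_assoc)
      then show ?thesis
        using len_mult_inv_alt_prod[OF w s t, of "Suc n"] \<open>\<not> P (Suc n)\<close> len_w
          len_mult_gen_neq[OF v, of r] that s t by (auto simp: P_def)
    next
      case False
      obtain k where k: "n = Suc k" using \<open>1 \<le> n\<close> by (cases n) auto
      have "v = w \<otimes> inv (alt_prod W s t k) \<otimes> r"
        using False that w s t by (auto simp: v_def A_def k inv_mult_group m_assoc split: if_splits)
      then have "v \<otimes> r = w \<otimes> inv (alt_prod W s t k)"
        using w s t that by (auto)
      then show ?thesis
        using len_mult_inv_alt_prod[OF w s t, of k] len_w by (simp add: k)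
    qed
    have "len v < len w" using len_w \<open>1 \<le> n\<close> by simp
    then have vs: "act v (a s) \<in> cone\<^sub>\<Delta>" and vt: "act v (a t) \<in> cone\<^sub>\<Delta>"
      using less.hyps v s t asc by auto
    define c where "c = - B (a s) (a t)"
    have "0 \<le> cheb c n \<and> 0 \<le> cheb c (Suc n)"
    proof (cases "ord (s \<otimes> t) = 0")
      case True
      then show ?thesis using form_infinite[OF s t \<open>s \<noteq> t\<close>] by (simp add: c_def cheb_nonneg del: cheb.simps)
    next
      case False
      define m where "m = ord (s \<otimes> t)"
      have "m \<noteq> 1"
        using ord_eq_1[of "s \<otimes> t"] s t \<open>s \<noteq> t\<close> unfolding m_def
        by (metis gen_carrier gen_inv inv_equality m_closed)
      moreover have "n < m"
      \<comment> \<open>Otherwise the braid relation shortens \<open>A \<otimes> s\<close>, making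
        \<open>w \<otimes> s\<close> shorter than \<open>w\<close>.\<close>
      proof (rule ccontr)
        assume "\<not> n < m"
        then have "len (A \<otimes> s) < n"
          unfolding A_def m_def using len_alt_prod_mult_gen[OF s t False, of n] by simp
        moreover have "len (w \<otimes> s) \<le> len v + len (A \<otimes> s)"
          unfolding w_eq using v A s len_mult_le by (simp add: m_assoc)
        ultimately show False using len_w \<open>len w < len (w \<otimes> s)\<close> by simp
      qed
      moreover have "c = cos (pi / real m)"
        using form_finite[OF s t \<open>s \<noteq> t\<close> False] by (simp add: c_def m_def)
      ultimately show ?thesis
        using False by (auto simp: m_def simp del: cheb.simps intro!: cheb_cos_pi_nonneg)
    qed
    then show ?thesis
      using act_alt_prod[OF reflects_gen[OF s] reflects_gen[OF t], of c n] v A vs vt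
      by (auto simp: w_eq act_mult act_simps c_def A_def[symmetric] simp del: cheb.simps intro: cone_comb)
  qed
qed

section \<open>Positive and negative roots\<close>

lemma root_act: "\<rho> \<in> \<Phi> \<Longrightarrow> w \<in> carrier W \<Longrightarrow> act w \<rho> \<in> \<Phi>"
  unfolding roots_def using act_mult by (smt (verit) gen_carrier m_closed mem_Collect_eq)

lemma root_reflects:
  assumes "\<rho> \<in> \<Phi>" obtains g where "g \<in> reflections W S" "reflects g \<rho>"
  using assms reflects_conj reflects_gen unfolding roots_def reflections_def by blast

lemma root_uminus:
  assumes "\<rho> \<in> \<Phi>" shows "- \<rho> \<in> \<Phi>"
proof -
  obtain g where "reflects g \<rho>" using root_reflects[OF assms] .
  then show ?thesis using reflectsD(1,4) root_act[OF assms] by metis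
qed

lemma root_nonzero: "\<rho> \<in> \<Phi> \<Longrightarrow> \<rho> \<noteq> 0"
  by (metis root_reflects reflectsD(2) bilinear_lzero[OF bilinear_form] zero_neq_one)

text \<open>One of \<open>w\<close> and \<open>w \<otimes> s\<close> is lengthened by
  \<open>s\<close>, and \<open>w \<otimes> s\<close> sends \<open>a s\<close> to
  \<open>- \<rho>\<close>.\<close>

lemma root_cone_cases:
  assumes "\<rho> \<in> \<Phi>" shows "\<rho> \<in> cone\<^sub>\<Delta> \<or> - \<rho> \<in> cone\<^sub>\<Delta>"
proof -
  obtain w s where w: "w \<in> carrier W" "s \<in> S" and \<rho>: "\<rho> = act w (a s)"
    using assms by (auto simp: roots_def)
  have "act (w \<otimes> s) (a s) = - \<rho>"
    using w reflectsD(4)[OF reflects_gen] by (simp add: \<rho> act_mult act_simps)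
  then show ?thesis
    using len_mult_gen_cases[OF w] act_simple_in_cone[OF w] act_simple_in_cone[of "w \<otimes> s" s] w
    by (auto simp: \<rho>)
qed

lemma pos_root_iff: "\<rho> \<in> \<Phi>\<^sub>p \<longleftrightarrow> \<rho> \<in> \<Phi> \<and> \<rho> \<in> cone\<^sub>\<Delta>"
  by (simp add: pos_roots_def)

lemma neg_root_iff: "\<rho> \<in> \<Phi>\<^sub>n \<longleftrightarrow> - \<rho> \<in> \<Phi>\<^sub>p"
  by (auto simp: neg_roots_def image_iff) (metis minus_minus)

lemma root_cases: "\<rho> \<in> \<Phi> \<Longrightarrow> \<rho> \<in> \<Phi>\<^sub>p \<or> \<rho> \<in> \<Phi>\<^sub>n"
  using root_cone_cases by (auto simp: pos_root_iff neg_root_iff root_uminus)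

lemma not_pos_and_neg: "\<rho> \<in> \<Phi>\<^sub>p \<Longrightarrow> \<rho> \<notin> \<Phi>\<^sub>n"
  using cone_pointed root_nonzero by (auto simp: pos_root_iff neg_root_iff)

lemma simple_pos_root: "s \<in> S \<Longrightarrow> a s \<in> \<Phi>\<^sub>p"
  unfolding pos_root_iff roots_def by (auto simp: simple_in_cone) (metis act_one one_closed)

lemma pos_rootI:
  assumes "\<rho> \<in> \<Phi>" "\<rho> = c *\<^sub>R \<gamma> + d *\<^sub>R \<eta>" "\<gamma> \<in> \<Phi>\<^sub>p" "\<eta> \<in> \<Phi>\<^sub>p" "0 \<le> c" "0 \<le> d"
  shows "\<rho> \<in> \<Phi>\<^sub>p"
  using assms by (auto simp: pos_root_iff intro: cone_comb)

lemma neg_rootI: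
  assumes "\<rho> \<in> \<Phi>" "\<rho> = c *\<^sub>R \<gamma> + d *\<^sub>R \<eta>" "\<gamma> \<in> \<Phi>\<^sub>p" "\<eta> \<in> \<Phi>\<^sub>p" "c \<le> 0" "d \<le> 0"
  shows "\<rho> \<in> \<Phi>\<^sub>n"
  unfolding neg_root_iff
proof (rule pos_rootI)
  show "- \<rho> \<in> \<Phi>" using assms(1) by (rule root_uminus)
  show "- \<rho> = (- c) *\<^sub>R \<gamma> + (- d) *\<^sub>R \<eta>" using assms(2) by simp
qed (use assms in auto)

lemma act_comb:
  assumes "w \<in> carrier W" "\<rho> = c *\<^sub>R \<gamma> + d *\<^sub>R \<eta>"
  shows "act w \<rho> = c *\<^sub>R act w \<gamma> + d *\<^sub>R act w \<eta>"
  using assms by (simp add: act_simps)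

lemma act_comb_pos:
  assumes "w \<in> carrier W" "\<rho> \<in> \<Phi>" "\<rho> = c *\<^sub>R \<gamma> + d *\<^sub>R \<eta>" "0 \<le> c" "0 \<le> d"
    and "act w \<gamma> \<in> \<Phi>\<^sub>p" "act w \<eta> \<in> \<Phi>\<^sub>p"
  shows "act w \<rho> \<in> \<Phi>\<^sub>p"
  using pos_rootI[OF root_act act_comb] assms by blast

lemma act_comb_neg:
  assumes "w \<in> carrier W" "\<rho> \<in> \<Phi>" "\<rho> = c *\<^sub>R \<gamma> + d *\<^sub>R \<eta>" "0 \<le> c" "0 \<le> d"
    and "act w \<gamma> \<in> \<Phi>\<^sub>n" "act w \<eta> \<in> \<Phi>\<^sub>n"
  shows "act w \<rho> \<in> \<Phi>\<^sub>n"
  unfolding neg_root_iff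
proof (rule pos_rootI)
  show "- act w \<rho> \<in> \<Phi>" using assms(1,2) by (intro root_uminus root_act)
  show "- act w \<rho> = c *\<^sub>R (- act w \<gamma>) + d *\<^sub>R (- act w \<eta>)"
    by (simp add: act_comb[OF assms(1,3)])
qed (use assms in \<open>simp_all add: neg_root_iff\<close>)

section \<open>Simple reflections and inversion sets\<close>

lemma inversion_iff: "\<alpha> \<in> N w \<longleftrightarrow> \<alpha> \<in> \<Phi>\<^sub>p \<and> act (inv w) \<alpha> \<in> \<Phi>\<^sub>n"
  by (simp add: inversions_def)

text \<open>
  The simple roots may be linearly dependent, so coefficients cannot be compared directly.
  Pairing with \<open>a s\<close> shows that \<open>\<mu>\<close> below is nonpositive; then positive independence applies.
\<close>
lemma gen_act_pos_root:
  assumes "s \<in> S" "\<rho> \<in> \<Phi>\<^sub>p" "\<rho> \<noteq> a s" shows "act s \<rho> \<in> \<Phi>\<^sub>p"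
proof (rule ccontr)
  assume neg: "act s \<rho> \<notin> \<Phi>\<^sub>p"
  have \<rho>: "\<rho> \<in> \<Phi>" "\<rho> \<in> cone\<^sub>\<Delta>" using assms by (auto simp: pos_root_iff)
  then have "- act s \<rho> \<in> cone\<^sub>\<Delta>"
    using neg root_cases[OF root_act[OF \<rho>(1), of s]] assms(1) by (auto simp: pos_root_iff neg_root_iff)
  then obtain d where d: "\<And>r. 0 \<le> d r" "- act s \<rho> = (\<Sum>r\<in>S. d r *\<^sub>R a r)"
    by (metis cone_coeffs)
  obtain c where c: "\<And>r. 0 \<le> c r" "\<rho> = (\<Sum>r\<in>S. c r *\<^sub>R a r)"
    using \<rho> by (metis cone_coeffs)
  define \<mu> where "\<mu> = 2 * B (a s) \<rho> - c s - d s"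
  let ?R = "\<Sum>r\<in>S - {s}. (c r + d r) *\<^sub>R a r"
  have "\<rho> - act s \<rho> = (\<Sum>r\<in>S. (c r + d r) *\<^sub>R a r)"
    by (simp add: scaleR_add_left sum.distrib flip: d(2) c(2))
  also have "\<dots> = (c s + d s) *\<^sub>R a s + ?R"
    using assms(1) finite_gens by (simp add: sum.remove)
  finally have R: "?R = \<mu> *\<^sub>R a s"
    using assms(1) by (simp add: act_gen \<mu>_def algebra_simps scaleR_diff_left)
  have "\<mu> = B (a s) ?R"
    unfolding R using assms(1) by (simp add: form_simps form_diag)
  also have "\<dots> \<le> 0"
    unfolding form_sum_right
    using c d assms(1) form_simple_nonpos by (intro sum_nonpos mult_nonneg_nonpos) auto
  finally have "\<mu> \<le> 0" .
  \<comment> \<open>Moving \<open>\<mu> *\<^sub>R a s\<close> across in \<open>R\<close> gives a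
    vanishing nonnegative combination, so \<open>c\<close> and \<open>d\<close> vanish off
    \<open>s\<close>.\<close>
  define e where "e r = (if r = s then - \<mu> else c r + d r)" for r
  have "(\<Sum>r\<in>S. e r *\<^sub>R a r) = - \<mu> *\<^sub>R a s + (\<Sum>r\<in>S - {s}. e r *\<^sub>R a r)"
    using assms(1) finite_gens by (simp add: sum.remove e_def)
  also have "(\<Sum>r\<in>S - {s}. e r *\<^sub>R a r) = ?R"
    by (intro sum.cong) (auto simp: e_def)
  finally have "(\<Sum>r\<in>S. e r *\<^sub>R a r) = 0" using R by simp
  moreover have "0 \<le> e r" for r using c d \<open>\<mu> \<le> 0\<close> by (simp add: e_def)
  ultimately have e0: "e r = 0" if "r \<in> S" for r using positively_independent that by blast
  have c0: "c r = 0" if "r \<in> S - {s}" for r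
    using that e0[of r] c(1)[of r] d(1)[of r] by (simp add: e_def)
  have "\<rho> = c s *\<^sub>R a s + (\<Sum>r\<in>S - {s}. c r *\<^sub>R a r)"
    using assms(1) finite_gens by (simp add: c(2) sum.remove)
  then have eq: "\<rho> = c s *\<^sub>R a s" using c0 by simp
  \<comment> \<open>Roots have norm 1, which leaves 1 as the only nonnegative multiple.\<close>
  obtain g where "reflects g \<rho>" using root_reflects[OF \<rho>(1)] .
  then have "B \<rho> \<rho> = 1" by (rule reflectsD)
  then have "c s * c s = 1" using assms(1) by (simp add: eq form_simps form_diag)
  then have "c s = 1" using c(1)[of s] square_eq_1_iff[of "c s"] by auto
  with eq assms(3) show False by simp
qed

text \<open>As \<open>s\<close> keeps every positive root except \<open>a s\<close> positive,
  passing from \<open>w\<close> to \<open>s \<otimes> w\<close> adds at most one inversion.\<close>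

lemma finite_inversions: "w \<in> carrier W \<Longrightarrow> finite (N w)"
proof (induction rule: carrier_induct)
  case one
  have "N \<one> = {}" by (auto simp: inversion_iff not_pos_and_neg)
  then show ?case by simp
next
  case (mult s w)
  have "N (s \<otimes> w) \<subseteq> insert (a s) (act s ` N w)"
  proof
    fix \<alpha> assume \<alpha>: "\<alpha> \<in> N (s \<otimes> w)"
    then have inv: "act s \<alpha> \<in> N w" if "\<alpha> \<noteq> a s"
      using that mult by (auto simp: inversion_iff inv_mult_group act_mult gen_act_pos_root)
    have "\<alpha> = act s (act s \<alpha>)" using mult by (simp flip: act_mult)
    then show "\<alpha> \<in> insert (a s) (act s ` N w)" using inv by blast
  qed
  with mult show ?case by (meson finite_imageI finite_insert finite_subset)
qed

lemma inversions_mult_gen: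
  assumes "w \<in> carrier W" "s \<in> S" "len w < len (w \<otimes> s)" shows "N w \<subseteq> N (w \<otimes> s)"
proof
  fix \<alpha> assume \<alpha>: "\<alpha> \<in> N w"
  define \<sigma> where "\<sigma> = - act (inv w) \<alpha>"
  have \<sigma>: "\<sigma> \<in> \<Phi>\<^sub>p" using \<alpha> by (simp add: \<sigma>_def inversion_iff neg_root_iff)
  have \<alpha>_eq: "\<alpha> = - act w \<sigma>" using assms by (simp add: \<sigma>_def act_simps)
  \<comment> \<open>For \<open>\<sigma> = a s\<close> the ascent would put \<open>- \<alpha>\<close>
    in the cone along with \<open>\<alpha>\<close>.\<close>
  have "\<sigma> \<noteq> a s"
    using act_simple_in_cone[OF assms] \<alpha> \<alpha>_eq cone_pointed[of \<alpha>] root_nonzero[of \<alpha>]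
    by (auto simp: inversion_iff pos_root_iff)
  then have "act s \<sigma> \<in> \<Phi>\<^sub>p" using gen_act_pos_root assms \<sigma> by simp
  moreover have "act (inv (w \<otimes> s)) \<alpha> = - act s \<sigma>"
    using assms by (simp add: \<sigma>_def inv_mult_group act_mult act_simps)
  ultimately show "\<alpha> \<in> N (w \<otimes> s)" using \<alpha> by (simp add: inversion_iff neg_root_iff)
qed

text \<open>Applied to the palindromic word of \<open>t\<close>, this makes all inversions of a
  \<open>t\<close>-prefix inversions of \<open>t\<close>.\<close>

lemma inversions_prefix:
  assumes "reduced_word_for W S w (us @ vs)" shows "N (word_prod W us) \<subseteq> N w"
  using assms
proof (induction vs arbitrary: w rule: rev_induct)
  case Nil
  then show ?case by (auto simp: reduced_word_for_iff)
next
  case (snoc s vs)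
  define x where "x = word_prod W (us @ vs)"
  have x: "reduced_word_for W S x (us @ vs)"
    using reduced_word_prefix[of w "us @ vs" "[s]"] snoc.prems by (simp add: x_def)
  have "set (us @ vs) \<subseteq> S" "s \<in> S" "w = x \<otimes> s" "x \<in> carrier W"
    using snoc.prems word_prod_append[of "us @ vs" "[s]"] unfolding x_def
    by (auto simp: reduced_word_for_iff)
  moreover from this have "len x < len (x \<otimes> s)"
    using x snoc.prems by (auto simp: reduced_word_for_iff)
  ultimately show ?case using inversions_mult_gen snoc.IH[OF x] by blast
qed

section \<open>Pairs of roots\<close>

text \<open>
  At the first nonpositive Chebyshev coefficient \<open>cheb c k\<close>, two alternating products \<open>x\<close> and \<open>y\<close>
  send \<open>\<eta>\<close> to a negative root and \<open>\<gamma>\<close> to opposite roots.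
\<close>
lemma ex_both_negative:
  assumes "reflects g \<gamma>" "reflects h \<eta>" "\<gamma> \<in> \<Phi>\<^sub>p" "\<eta> \<in> \<Phi>\<^sub>p"
    and "B \<gamma> \<eta> = - c" "0 \<le> c" "c < 1"
  obtains v where "v \<in> carrier W" "act v \<gamma> \<in> \<Phi>\<^sub>n" "act v \<eta> \<in> \<Phi>\<^sub>n"
proof -
  have gh: "g \<in> carrier W" "h \<in> carrier W" and roots: "\<gamma> \<in> \<Phi>" "\<eta> \<in> \<Phi>"
    using assms by (auto dest: reflectsD simp: pos_root_iff)
  have sym: "B \<eta> \<gamma> = - c" using assms(5) symmetric_form by simp
  obtain k where k: "2 \<le> k" "cheb c k \<le> 0" "\<And>j. 0 < j \<Longrightarrow> j < k \<Longrightarrow> 0 < cheb c j"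
    using cheb_first_nonpos[OF assms(6,7)] by blast
  \<comment> \<open>Coefficients \<open>j\<close> and \<open>j + 1\<close> are nonnegative and serve
    \<open>x\<close>; \<open>j + 2\<close> and \<open>j + 3\<close> are nonpositive and serve
    \<open>y\<close>.\<close>
  define j where "j = k - 2"
  have kj: "k = Suc (Suc j)" using k by (simp add: j_def)
  have j0: "0 \<le> cheb c j" using k(3)[of j] kj by (cases "j = 0") auto
  have j1: "0 \<le> cheb c (Suc j)" using k(3)[of "Suc j"] kj by simp
  have j3: "cheb c (Suc (Suc (Suc j))) \<le> 0"
    using cheb_nonpos_Suc[OF assms(6), of "Suc j"] k(2) kj j1 by simp
  define x where "x = alt_prod W g h (Suc j)"
  define y where "y = alt_prod W h g (Suc (Suc j))"
  have x: "x \<in> carrier W" and y: "y \<in> carrier W" using gh by (simp_all add: x_def y_def del: alt_prod.simps)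
  \<comment> \<open>The last letter of \<open>x\<close> is \<open>h\<close>, which negates
    \<open>\<eta>\<close>.\<close>
  have "act x \<eta> = - act (alt_prod W h g j) \<eta>"
    using gh reflectsD(4)[OF assms(2)] unfolding x_def
    by (simp add: alt_prod_Suc_right act_mult act_simps del: alt_prod.simps)
  moreover have "act (alt_prod W h g j) \<eta> \<in> \<Phi>\<^sub>p"
    using act_alt_prod[OF assms(2,1) sym, of j] root_act[OF roots(2), of "alt_prod W h g j"] gh
      assms(3,4) j0 j1
    by (cases "even j") (auto simp del: cheb.simps intro: pos_rootI)
  ultimately have x\<eta>: "act x \<eta> \<in> \<Phi>\<^sub>n" by (simp add: neg_root_iff)
  have y\<eta>: "act y \<eta> \<in> \<Phi>\<^sub>n"
    using act_alt_prod[OF assms(2,1) sym, of "Suc (Suc j)"] root_act[OF roots(2) y]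
      assms(3,4) k(2) kj j3 unfolding y_def
    by (cases "even j") (auto simp del: cheb.simps alt_prod.simps intro: neg_rootI)
  \<comment> \<open>\<open>y\<close> equals \<open>x \<otimes> g\<close>, and \<open>g\<close>
    negates \<open>\<gamma>\<close>; so \<open>x\<close> or \<open>y\<close> makes
    \<open>\<gamma>\<close> negative.\<close>
  have y\<gamma>: "act y \<gamma> = - act x \<gamma>"
    using gh reflectsD(4)[OF assms(1)] unfolding x_def y_def
    by (simp add: alt_prod_Suc_right[of h g "Suc j"] act_mult act_simps del: alt_prod.simps)
  show ?thesis
  proof (cases "act x \<gamma> \<in> \<Phi>\<^sub>n")
    case True
    then show ?thesis using that x x\<eta> by blast
  next
    case False
    then have "act x \<gamma> \<in> \<Phi>\<^sub>p" using root_cases[OF root_act[OF roots(1) x]] by blast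
    then show ?thesis using that y y\<eta> y\<gamma> by (simp add: neg_root_iff)
  qed
qed

text \<open>Pairing the difference of two equal orbit points with \<open>\<gamma>\<close> and
  \<open>\<eta>\<close> kills its coefficients, except for \<open>c = 1\<close>, where
  \<open>\<gamma> + \<eta> = 0\<close> would follow.\<close>

lemma inj_alt_prod_orbit:
  assumes "reflects g \<gamma>" "reflects h \<eta>" "B \<gamma> \<eta> = - c" "1 \<le> c" "\<gamma> + \<eta> \<noteq> 0"
  shows "inj (\<lambda>n. act (alt_prod W g h (2 * n)) \<gamma>)"
proof (rule injI)
  fix m n :: nat
  define u u' where "u = cheb c (Suc (2 * m)) - cheb c (Suc (2 * n))"
    and "u' = cheb c (2 * m) - cheb c (2 * n)"
  assume "act (alt_prod W g h (2 * m)) \<gamma> = act (alt_prod W g h (2 * n)) \<gamma>"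
  then have z: "u *\<^sub>R \<gamma> + u' *\<^sub>R \<eta> = 0"
    by (simp add: act_alt_prod[OF assms(1-3)] u_def u'_def algebra_simps del: cheb.simps alt_prod.simps)
  have "B \<gamma> (u *\<^sub>R \<gamma> + u' *\<^sub>R \<eta>) = 0" "B \<eta> (u *\<^sub>R \<gamma> + u' *\<^sub>R \<eta>) = 0"
    unfolding z by (simp_all add: form_simps)
  then have "u = c * u'" "u' = c * u"
    using assms(3) reflectsD(2)[OF assms(1)] reflectsD(2)[OF assms(2)] symmetric_form[of \<eta> \<gamma>]
    by (simp_all add: form_simps)
  have "u = 0"
  proof (rule ccontr)
    assume "u \<noteq> 0"
    have "u = (c * c) * u" using \<open>u = c * u'\<close> \<open>u' = c * u\<close> by (metis mult.assoc)
    then have "c * c = 1" using \<open>u \<noteq> 0\<close> by simp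
    then have "c = 1" using assms(4) square_eq_1_iff[of c] by auto
    then have "u *\<^sub>R (\<gamma> + \<eta>) = 0" using z \<open>u' = c * u\<close> by (simp add: algebra_simps)
    then show False using \<open>u \<noteq> 0\<close> assms(5) by simp
  qed
  then have "Suc (2 * m) = Suc (2 * n)"
    using strict_mono_eq[OF cheb_strict_mono[OF assms(4)]] unfolding u_def by (metis eq_iff_diff_eq_0)
  then show "m = n" by simp
qed

text \<open>Otherwise infinitely many orbit points, nonnegative combinations of
  \<open>\<gamma>\<close> and \<open>\<eta>\<close>, are inversions of \<open>inv v\<close>.\<close>

lemma not_both_negative:
  assumes "\<gamma> \<in> \<Phi>\<^sub>p" "\<eta> \<in> \<Phi>\<^sub>p" "B \<gamma> \<eta> \<le> -1" "v \<in> carrier W" "act v \<gamma> \<in> \<Phi>\<^sub>n"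
  shows "act v \<eta> \<notin> \<Phi>\<^sub>n"
proof
  assume neg: "act v \<eta> \<in> \<Phi>\<^sub>n"
  have roots: "\<gamma> \<in> \<Phi>" "\<eta> \<in> \<Phi>" using assms by (auto simp: pos_root_iff)
  obtain g h where r: "reflects g \<gamma>" "reflects h \<eta>" using root_reflects roots by metis
  then have gh: "g \<in> carrier W" "h \<in> carrier W" by (auto dest: reflectsD)
  define c where "c = - B \<gamma> \<eta>"
  have c: "B \<gamma> \<eta> = - c" "1 \<le> c" using assms by (simp_all add: c_def)
  have "\<gamma> + \<eta> \<noteq> 0"
    using assms(1,2) by (metis add_eq_0_iff neg_root_iff not_pos_and_neg)
  note inj = inj_alt_prod_orbit[OF r c this]
  have "act (alt_prod W g h (2 * n)) \<gamma> \<in> N (inv v)" for n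
  proof -
    let ?\<rho> = "act (alt_prod W g h (2 * n)) \<gamma>"
    have eq: "?\<rho> = cheb c (Suc (2 * n)) *\<^sub>R \<gamma> + cheb c (2 * n) *\<^sub>R \<eta>"
      using act_alt_prod[OF r c(1), of "2 * n"] by simp
    have \<rho>: "?\<rho> \<in> \<Phi>" using gh by (intro root_act roots) simp
    have "?\<rho> \<in> \<Phi>\<^sub>p"
      using pos_rootI[OF \<rho> eq] assms cheb_nonneg[OF c(2)] by blast
    moreover have "act v ?\<rho> \<in> \<Phi>\<^sub>n"
      using act_comb_neg[OF assms(4) \<rho> eq] assms(5) neg cheb_nonneg[OF c(2)] by blast
    ultimately show ?thesis using assms(4) by (simp add: inversion_iff)
  qed
  then have "range (\<lambda>n. act (alt_prod W g h (2 * n)) \<gamma>) \<subseteq> N (inv v)" by blast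
  then have "finite (range (\<lambda>n. act (alt_prod W g h (2 * n)) \<gamma>))"
    using finite_inversions assms(4) by (meson finite_subset inv_closed)
  with inj show False using finite_imageD infinite_UNIV_nat by blast
qed

text \<open>Distinct orbit points need distinct group elements;
  \<open>\<gamma> + \<eta> \<noteq> 0\<close> keeps out the case \<open>g = h\<close>.\<close>

lemma infinite_generate_reflections:
  assumes "reflects g \<gamma>" "reflects h \<eta>" "B \<gamma> \<eta> \<le> -1" "\<gamma> + \<eta> \<noteq> 0"
  shows "infinite (generate W {g, h})"
proof
  assume fin: "finite (generate W {g, h})"
  have "inj (\<lambda>n. act (alt_prod W g h (2 * n)) \<gamma>)"
    by (rule inj_alt_prod_orbit[OF assms(1,2), of "- B \<gamma> \<eta>"]) (use assms in auto)
  then have "inj (\<lambda>n. alt_prod W g h (2 * n))" by (auto simp: inj_on_def)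
  moreover have "finite (range (\<lambda>n. alt_prod W g h (2 * n)))"
    using alt_prod_in_generate by (intro finite_subset[OF _ fin]) auto
  ultimately show False using finite_imageD infinite_UNIV_nat by blast
qed

lemma reflects_square: "reflects g \<gamma> \<Longrightarrow> g \<otimes> g = \<one>"
  by (rule act_eqI) (auto simp: act_mult reflectsD form_simps algebra_simps)

text \<open>
  The inversions separating \<open>u\<close> from \<open>v\<close> contain every root in the cone of \<open>\<gamma>\<close> and \<open>\<eta>\<close>, so this cone
  has finitely many roots.  Of two consecutive roots in the dihedral orbit of \<open>\<gamma>\<close>, one lies in this
  cone up to sign (this uses \<open>c \<ge> 0\<close>); hence the orbit repeats and \<open>g \<otimes> h\<close> has finite order.
\<close>
lemma finite_generate_reflections:
  assumes "reflects g \<gamma>" "reflects h \<eta>" "\<gamma> \<in> \<Phi>" "\<eta> \<in> \<Phi>" "B \<gamma> \<eta> = - c" "0 \<le> c"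
    and u: "u \<in> carrier W" "act u \<gamma> \<in> \<Phi>\<^sub>p" "act u \<eta> \<in> \<Phi>\<^sub>p"
    and v: "v \<in> carrier W" "act v \<gamma> \<in> \<Phi>\<^sub>n" "act v \<eta> \<in> \<Phi>\<^sub>n"
  shows "finite (generate W {g, h})"
proof -
  have gh: "g \<in> carrier W" "h \<in> carrier W" "g \<otimes> g = \<one>" "h \<otimes> h = \<one>"
    using assms(1,2) by (auto dest: reflectsD reflects_square)
  \<comment> \<open>\<open>F\<close> consists of the roots that \<open>u\<close> makes positive and
    \<open>v\<close> makes negative.\<close>
  define F where "F = act (inv u) ` N (u \<otimes> inv v)"
  have "finite F" using u v by (simp add: F_def finite_inversions)
  have F: "\<rho> \<in> F" if "\<rho> \<in> \<Phi>" "\<rho> = d *\<^sub>R \<gamma> + e *\<^sub>R \<eta>" "0 \<le> d" "0 \<le> e" for \<rho> d e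
  proof -
    have "act u \<rho> \<in> \<Phi>\<^sub>p"
      using act_comb_pos[OF u(1) that] u by blast
    moreover have "act v \<rho> \<in> \<Phi>\<^sub>n"
      using act_comb_neg[OF v(1) that] v by blast
    moreover have "act (inv (u \<otimes> inv v)) (act u \<rho>) = act v \<rho>"
      using u v by (simp add: inv_mult_group act_mult)
    ultimately have "act u \<rho> \<in> N (u \<otimes> inv v)" by (simp add: inversion_iff)
    then have "act (inv u) (act u \<rho>) \<in> F" unfolding F_def by blast
    then show ?thesis using u by simp
  qed
  define x where "x n = act (alt_prod W g h n) \<gamma>" for n
  have x: "x n \<in> \<Phi>" for n unfolding x_def using gh by (intro root_act assms) simp
  define E where "E = F \<union> uminus ` F"
  have E: "x n \<in> E"
    if sgn: "0 \<le> cheb c n \<and> 0 \<le> cheb c (Suc n) \<or> cheb c n \<le> 0 \<and> cheb c (Suc n) \<le> 0" for n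
  proof -
    obtain d e where de: "x n = d *\<^sub>R \<gamma> + e *\<^sub>R \<eta>" "0 \<le> d \<and> 0 \<le> e \<or> d \<le> 0 \<and> e \<le> 0"
    proof (cases "even n")
      case True
      with act_alt_prod[OF assms(1,2,5), of n] sgn show ?thesis
        by (intro that[of "cheb c (Suc n)" "cheb c n"]) (auto simp: x_def simp del: cheb.simps)
    next
      case False
      with act_alt_prod[OF assms(1,2,5), of n] sgn show ?thesis
        by (intro that[of "cheb c n" "cheb c (Suc n)"]) (auto simp: x_def simp del: cheb.simps)
    qed
    show ?thesis
    proof (cases "0 \<le> d \<and> 0 \<le> e")
      case True
      then show ?thesis using F[OF x de(1)] by (simp add: E_def)
    next
      case False
      then have "- x n \<in> F"
        using de F[OF root_uminus[OF x[of n]], of "- d" "- e"] by (simp only: de(1)) auto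
      then have "- (- x n) \<in> E" unfolding E_def by blast
      then show ?thesis by simp
    qed
  qed
  \<comment> \<open>If the signs at \<open>n\<close> and \<open>n + 1\<close> disagree, those at
    \<open>n + 1\<close> and \<open>n + 2\<close> agree.\<close>
  have E2: "x n \<in> E \<or> x (Suc n) \<in> E" for n
    using E[of n] E[of "Suc n"] cheb_nonpos_Suc[OF assms(6), of n] cheb_nonneg_Suc[OF assms(6), of n]
      linear[of "cheb c n" 0] linear[of "cheb c (Suc n)" 0]
    by blast
  have "infinite {n. x n \<in> E}"
    unfolding infinite_nat_iff_unbounded_le
  proof
    fix m show "\<exists>n\<ge>m. n \<in> {n. x n \<in> E}"
      using E2[of m] le_SucI[of m m] by blast
  qed
  \<comment> \<open>Parity is recorded because conjugates are comparable only at equal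
    parity.\<close>
  moreover have "finite ((\<lambda>n. (even n, x n)) ` {n. x n \<in> E})"
  proof (rule finite_subset)
    show "(\<lambda>n. (even n, x n)) ` {n. x n \<in> E} \<subseteq> (UNIV :: bool set) \<times> E" by auto
    show "finite ((UNIV :: bool set) \<times> E)" using \<open>finite F\<close> by (intro finite_cartesian_product) (simp_all add: E_def)
  qed
  ultimately have "\<not> inj_on (\<lambda>n. (even n, x n)) {n. x n \<in> E}"
    using finite_imageD by blast
  then obtain i j where "i \<noteq> j" "even i = even j" "x i = x j" by (auto simp: inj_on_def)
  then obtain i j where ij: "i < j" "even i = even j" "x i = x j"
    by (metis linorder_neqE_nat)
  have refl: "reflects (alt_prod W g h n \<otimes> g \<otimes> inv (alt_prod W g h n)) (x n)" for n
    unfolding x_def using gh by (intro reflects_conj assms) simp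
  have "(g \<otimes> h) [^] i = (g \<otimes> h) [^] j"
    using reflects_unique[OF refl[of i] refl[of j, folded ij(3)]] ij(2) gh
    by (auto simp: alt_prod_conj split: if_splits)
  then have "(g \<otimes> h) [^] (j - i) = \<one>" using gh pow_eq_div2 by (metis m_closed)
  then have "ord (g \<otimes> h) dvd j - i" using gh pow_eq_id by simp
  then have "ord (g \<otimes> h) \<noteq> 0" using ij(1) by (auto intro!: Nat.gr0I)
  then show ?thesis using finite_generate_involutions gh by blast
qed

section \<open>The correspondence between positive roots and reflections\<close>

lemma refl_of_root_eq:
  assumes "t \<in> reflections W S" "reflects t \<beta>" shows "refl_of_root W S B act \<beta> = t"
  unfolding refl_of_root_def
proof (rule the_equality)
  fix g assume g: "g \<in> reflections W S \<and> (\<forall>v. act g v = v - (2 * B \<beta> v) *\<^sub>R \<beta>)"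
  then have "reflects g \<beta>"
    using assms by (auto simp: reflects_def reflections_def)
  then show "g = t" using assms reflects_unique by blast
qed (use assms in \<open>auto simp: reflects_def\<close>)

lemma reflects_refl_of_root:
  assumes "\<beta> \<in> \<Phi>"
  shows "reflects (refl_of_root W S B act \<beta>) \<beta>" "refl_of_root W S B act \<beta> \<in> reflections W S"
  using root_reflects[OF assms] refl_of_root_eq by metis+

lemma root_of_refl_eq:
  assumes "t \<in> reflections W S" "reflects t \<beta>" "\<beta> \<in> \<Phi>\<^sub>p"
  shows "root_of_refl W S B a act t = \<beta>"
  unfolding root_of_refl_def
proof (rule the_equality)
  fix \<alpha> assume \<alpha>: "\<alpha> \<in> \<Phi>\<^sub>p \<and> refl_of_root W S B act \<alpha> = t"
  then have "reflects t \<alpha>" using reflects_refl_of_root pos_root_iff by blast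
  then show "\<alpha> = \<beta>"
    using reflects_same_root[OF assms(2)] assms(3) \<alpha> not_pos_and_neg[of \<beta>] by (auto simp: neg_root_iff)
qed (use assms refl_of_root_eq in auto)

lemma reflection_pos_root:
  assumes "t \<in> reflections W S" obtains \<beta> where "\<beta> \<in> \<Phi>\<^sub>p" "reflects t \<beta>"
proof -
  obtain w s where w: "w \<in> carrier W" "s \<in> S" "t = w \<otimes> s \<otimes> inv w"
    using assms by (auto simp: reflections_def)
  have "reflects t (act w (a s))" using w reflects_conj reflects_gen by simp
  moreover have "act w (a s) \<in> \<Phi>" using w by (auto simp: roots_def)
  ultimately show ?thesis
    using that root_cases reflects_uminus neg_root_iff by metis
qed

section \<open>Dominance and reflection prefixes\<close>

lemma refl_prefix_closed: "is_prefix_of_refl W S t p \<Longrightarrow> p \<in> carrier W"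
  by (simp add: is_prefix_of_refl_def)

text \<open>With \<open>p = q \<otimes> s\<close>: as \<open>s\<close> makes no positive root but
  \<open>a s\<close> negative, inversions of \<open>p\<close> other than \<open>\<beta>\<close> are
  inversions of \<open>q\<close>.\<close>

lemma refl_prefix_cases:
  assumes \<beta>: "\<beta> \<in> \<Phi>\<^sub>p" and t: "reflects t \<beta>" and p: "is_prefix_of_refl W S t p"
  obtains q s where "q \<in> carrier W" "s \<in> S" "\<beta> = act q (a s)" "\<beta> \<in> N p" "N p \<subseteq> N t"
    "\<And>\<alpha>. \<alpha> \<in> N p \<Longrightarrow> \<alpha> \<noteq> \<beta> \<Longrightarrow> - act (inv q) \<alpha> \<in> \<Phi>\<^sub>p"
proof -
  obtain ps where ps: "reduced_word_for W S p ps"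
    using p reduced_word_exists by (auto simp: is_prefix_of_refl_def)
  moreover have "ps \<noteq> []" using ps p by (auto simp: reduced_word_for_iff is_prefix_of_refl_def)
  ultimately obtain ws s where ws: "reduced_word_for W S p (ws @ [s])"
    by (metis rev_exhaust)
  define q where "q = word_prod W ws"
  have S: "set ws \<subseteq> S" "s \<in> S" and p_eq: "p = q \<otimes> s"
    using ws by (auto simp: reduced_word_for_iff q_def word_prod_append)
  have q: "q \<in> carrier W" using S by (simp add: q_def)
  have red: "reduced_word_for W S t ((ws @ [s]) @ rev ws)"
    using p ws by (simp add: is_prefix_of_refl_def)
  then have "t = q \<otimes> s \<otimes> inv q"
    using S q by (simp add: reduced_word_for_iff q_def word_prod_append word_prod_rev m_assoc)
  then have "reflects t (act q (a s))" using reflects_conj reflects_gen S q by simp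
  then have "\<beta> = act q (a s) \<or> \<beta> = - act q (a s)" using t by (rule reflects_same_root)
  \<comment> \<open>The reflection fixes its root only up to sign; the ascent of \<open>q\<close> at
    \<open>s\<close> settles the sign.\<close>
  moreover have "len q < len (q \<otimes> s)"
    using ws reduced_word_prefix[OF ws] by (simp add: reduced_word_for_iff q_def[symmetric] p_eq)
  then have "act q (a s) \<in> \<Phi>\<^sub>p"
    using S q act_simple_in_cone by (auto simp: pos_root_iff roots_def)
  then have "- act q (a s) \<notin> \<Phi>\<^sub>p" using not_pos_and_neg neg_root_iff by blast
  ultimately have \<beta>_eq: "\<beta> = act q (a s)" using \<beta> by auto
  have inv_p: "act (inv p) v = act s (act (inv q) v)" for v
    using S q by (simp add: p_eq inv_mult_group act_mult)
  have "act (inv p) \<beta> = - a s"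
    using S q reflectsD(4)[OF reflects_gen] by (simp add: inv_p \<beta>_eq)
  then have "\<beta> \<in> N p" using \<beta> simple_pos_root[OF S(2)] by (simp add: inversion_iff neg_root_iff)
  moreover have "N p \<subseteq> N t"
    using inversions_prefix[OF red] ws by (simp add: reduced_word_for_iff)
  moreover have "- act (inv q) \<alpha> \<in> \<Phi>\<^sub>p" if \<alpha>: "\<alpha> \<in> N p" "\<alpha> \<noteq> \<beta>" for \<alpha>
  proof (rule ccontr)
    assume "- act (inv q) \<alpha> \<notin> \<Phi>\<^sub>p"
    moreover have "act (inv q) \<alpha> \<in> \<Phi>"
      using \<alpha> q by (intro root_act) (auto simp: inversion_iff pos_root_iff)
    ultimately have "act (inv q) \<alpha> \<in> \<Phi>\<^sub>p" using root_cases neg_root_iff by blast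
    moreover have "act (inv q) \<alpha> \<noteq> a s" using \<alpha>(2) q unfolding \<beta>_eq by (metis act_cancel_inv)
    ultimately have "act (inv p) \<alpha> \<in> \<Phi>\<^sub>p" using gen_act_pos_root S inv_p by simp
    then show False using \<alpha>(1) not_pos_and_neg by (simp add: inversion_iff)
  qed
  ultimately show ?thesis using that q S \<beta>_eq by blast
qed

text \<open>If \<open>B \<alpha> \<beta> \<le> 0\<close>, then \<open>t\<close> sends
  \<open>\<alpha>\<close> to a nonnegative combination of \<open>\<alpha>\<close> and
  \<open>\<beta>\<close>.\<close>

lemma inversion_of_reflection_form_pos:
  assumes "\<beta> \<in> \<Phi>\<^sub>p" "reflects t \<beta>" "\<alpha> \<in> N t" shows "0 < B \<alpha> \<beta>"
proof (rule ccontr)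
  assume "\<not> 0 < B \<alpha> \<beta>"
  have t: "t \<in> carrier W" "inv t = t"
    using reflectsD(1) reflects_square assms(2) by (auto intro: inv_equality)
  have \<alpha>: "\<alpha> \<in> \<Phi>\<^sub>p" "act t \<alpha> \<in> \<Phi>\<^sub>n" using assms(3) t by (simp_all add: inversion_iff)
  have "act t \<alpha> = 1 *\<^sub>R \<alpha> + (- 2 * B \<alpha> \<beta>) *\<^sub>R \<beta>"
    using reflectsD(3)[OF assms(2)] symmetric_form[of \<beta> \<alpha>] by simp
  then have "act t \<alpha> \<in> \<Phi>\<^sub>p"
    by (rule pos_rootI[rotated])
      (use \<alpha> assms(1) t root_act \<open>\<not> 0 < B \<alpha> \<beta>\<close> in \<open>auto simp: pos_root_iff\<close>)
  then show False using \<alpha> not_pos_and_neg by blast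
qed

context
  fixes \<beta> t p
  assumes \<beta>: "\<beta> \<in> \<Phi>\<^sub>p" and t: "reflects t \<beta>" and p: "is_prefix_of_refl W S t p"
begin

text \<open>The substitution \<open>v = inv w \<otimes> q\<close>, that is
  \<open>w = q \<otimes> inv v\<close>, turns a failure of dominance at \<open>w\<close> into two
  positive roots made negative by \<open>v\<close>.\<close>

lemma Dom_eq_form_ge_1: "Dom W S a act \<beta> = {\<alpha> \<in> N p. 1 \<le> B \<alpha> \<beta>}"
proof -
  obtain q s where q: "q \<in> carrier W" and s: "s \<in> S" and \<beta>_eq: "\<beta> = act q (a s)"
    and "\<beta> \<in> N p" and Np_Nt: "N p \<subseteq> N t"
    and \<eta>: "\<And>\<alpha>. \<alpha> \<in> N p \<Longrightarrow> \<alpha> \<noteq> \<beta> \<Longrightarrow> - act (inv q) \<alpha> \<in> \<Phi>\<^sub>p"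
    using refl_prefix_cases[OF \<beta> t p] by blast
  have \<gamma>: "a s \<in> \<Phi>\<^sub>p" using s by (rule simple_pos_root)
  have form: "B (a s) (- act (inv q) \<alpha>) = - B \<alpha> \<beta>" for \<alpha>
    using form_act[OF q, of "a s" "act (inv q) \<alpha>"] q symmetric_form[of \<beta> \<alpha>]
    by (simp add: \<beta>_eq form_simps)
  have "dominated_by W S a act \<alpha> \<beta> \<longleftrightarrow> 1 \<le> B \<alpha> \<beta>" if \<alpha>: "\<alpha> \<in> N p" for \<alpha>
  proof (cases "\<alpha> = \<beta>")
    case True
    then show ?thesis using reflectsD(2)[OF t] by (simp add: dominated_by_def)
  next
    case False
    note \<eta> = \<eta>[OF \<alpha> False]
    show ?thesis
    proof
      assume dom: "dominated_by W S a act \<alpha> \<beta>"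
      show "1 \<le> B \<alpha> \<beta>"
      proof (rule ccontr)
        assume "\<not> 1 \<le> B \<alpha> \<beta>"
        moreover have "0 < B \<alpha> \<beta>"
          using inversion_of_reflection_form_pos[OF \<beta> t] \<alpha> Np_Nt by blast
        moreover obtain h where "reflects h (- act (inv q) \<alpha>)"
          using root_reflects \<eta> pos_root_iff by metis
        ultimately obtain v where v: "v \<in> carrier W" "act v (a s) \<in> \<Phi>\<^sub>n"
            "act v (- act (inv q) \<alpha>) \<in> \<Phi>\<^sub>n"
          using ex_both_negative[OF reflects_gen[OF s] _ \<gamma> \<eta> form] by force
        have inv_w: "act (inv (q \<otimes> inv v)) u = act v (act (inv q) u)" for u
          using q v(1) by (simp add: inv_mult_group act_mult)
        have "\<beta> \<in> N (q \<otimes> inv v)"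
          using \<beta> v(2) q by (simp add: inversion_iff inv_w) (simp add: \<beta>_eq)
        then have "\<alpha> \<in> N (q \<otimes> inv v)"
          using dom q v(1) by (simp add: dominated_by_def)
        then have "act v (act (inv q) \<alpha>) \<in> \<Phi>\<^sub>n" by (simp add: inversion_iff inv_w)
        then show False
          using v(1,3) not_pos_and_neg by (simp add: act_simps neg_root_iff)
      qed
    next
      assume ge: "1 \<le> B \<alpha> \<beta>"
      show "dominated_by W S a act \<alpha> \<beta>"
        unfolding dominated_by_def
      proof (intro ballI impI)
        fix w assume w: "w \<in> carrier W" and "\<beta> \<in> N w"
        then have "act (inv w \<otimes> q) (a s) \<in> \<Phi>\<^sub>n"
          using q by (simp add: inversion_iff act_mult \<beta>_eq)
        then have "act (inv w \<otimes> q) (- act (inv q) \<alpha>) \<notin> \<Phi>\<^sub>n"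
          using not_both_negative[OF \<gamma> \<eta>] form ge w q by simp
        then have "act (inv w) \<alpha> \<notin> \<Phi>\<^sub>p"
          using w q by (simp add: act_mult act_simps neg_root_iff)
        moreover have "act (inv w) \<alpha> \<in> \<Phi>"
          using \<alpha> w by (intro root_act) (auto simp: inversion_iff pos_root_iff)
        ultimately show "\<alpha> \<in> N w" using \<alpha> root_cases by (auto simp: inversion_iff)
      qed
    qed
  qed
  \<comment> \<open>Dominance is tested at \<open>p\<close> itself, which inverts
    \<open>\<beta>\<close>.\<close>
  moreover have "\<alpha> \<in> N p" if "dominated_by W S a act \<alpha> \<beta>" for \<alpha>
    using that \<open>\<beta> \<in> N p\<close> refl_prefix_closed[OF p] unfolding dominated_by_def by blast
  moreover have "N p \<subseteq> \<Phi>\<^sub>p" by (auto simp: inversion_iff)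
  ultimately show ?thesis unfolding Dom_def by blast
qed

text \<open>Replacing \<open>\<alpha>\<close> by \<open>- \<alpha>\<close> keeps its reflection and
  gives the pair a negative form value; \<open>inv q\<close> then makes \<open>\<beta>\<close> and
  \<open>- \<alpha>\<close> both positive.\<close>

lemma infinite_generate_iff_form_ge_1:
  assumes \<alpha>: "\<alpha> \<in> N p" "\<alpha> \<noteq> \<beta>" and g: "reflects g \<alpha>"
  shows "infinite (generate W {g, t}) \<longleftrightarrow> 1 \<le> B \<alpha> \<beta>"
proof -
  obtain q s where q: "q \<in> carrier W" and s: "s \<in> S" and \<beta>_eq: "\<beta> = act q (a s)"
    and Np_Nt: "N p \<subseteq> N t" and \<eta>: "- act (inv q) \<alpha> \<in> \<Phi>\<^sub>p"
    using refl_prefix_cases[OF \<beta> t p] \<alpha> by metis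
  have \<gamma>: "act (inv q) \<beta> = a s" "a s \<in> \<Phi>\<^sub>p" using q s simple_pos_root by (simp_all add: \<beta>_eq)
  have g': "reflects g (- \<alpha>)" using g by (rule reflects_uminus)
  have form: "B \<beta> (- \<alpha>) = - B \<alpha> \<beta>" using symmetric_form[of \<beta> \<alpha>] by (simp add: form_simps)
  have roots: "\<beta> \<in> \<Phi>" "- \<alpha> \<in> \<Phi>" using \<beta> \<alpha>(1) root_uminus[of \<alpha>] by (auto simp: inversion_iff pos_root_iff)
  have neg: "act (inv q) (- \<alpha>) = - act (inv q) \<alpha>" using q by (simp add: act_simps)
  have "finite (generate W {t, g})" if lt: "B \<alpha> \<beta> < 1"
  proof -
    have pos: "0 < B \<alpha> \<beta>"
      using inversion_of_reflection_form_pos[OF \<beta> t] \<alpha> Np_Nt by blast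
    have form': "B (a s) (- act (inv q) \<alpha>) = - B \<alpha> \<beta>"
      using form_act[of "inv q" \<beta> "- \<alpha>"] q form \<gamma> neg by simp
    obtain h where "reflects h (- act (inv q) \<alpha>)"
      using root_reflects \<eta> pos_root_iff by metis
    then obtain v where v: "v \<in> carrier W" "act v (a s) \<in> \<Phi>\<^sub>n" "act v (- act (inv q) \<alpha>) \<in> \<Phi>\<^sub>n"
      using ex_both_negative[OF reflects_gen[OF s] _ \<gamma>(2) \<eta> form'] pos lt by force
    show ?thesis
    proof (rule finite_generate_reflections[OF t g' roots form])
      show "act (inv q) \<beta> \<in> \<Phi>\<^sub>p" "act (inv q) (- \<alpha>) \<in> \<Phi>\<^sub>p" using \<gamma> \<eta> neg by simp_all
      show "act (v \<otimes> inv q) \<beta> \<in> \<Phi>\<^sub>n" "act (v \<otimes> inv q) (- \<alpha>) \<in> \<Phi>\<^sub>n"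
        using v q \<gamma> neg by (simp_all add: act_mult)
    qed (use pos v q in auto)
  qed
  moreover have "infinite (generate W {t, g})" if "1 \<le> B \<alpha> \<beta>"
    using infinite_generate_reflections[OF t g'] that form \<alpha>(2) by simp
  ultimately show ?thesis by (metis insert_commute not_le)
qed

text \<open>\<open>\<beta>\<close> is inserted separately: its form value is 1, yet \<open>t\<close>
  alone generates a finite group.\<close>

lemma Dom_eq_infinite_generate:
  "Dom W S a act \<beta> =
    insert \<beta> {\<alpha> \<in> N p. infinite (generate W {refl_of_root W S B act \<alpha>, t})}"
proof -
  have "1 \<le> B \<alpha> \<beta> \<longleftrightarrow> \<alpha> = \<beta> \<or> infinite (generate W {refl_of_root W S B act \<alpha>, t})"
    if "\<alpha> \<in> N p" for \<alpha>
  proof (cases "\<alpha> = \<beta>")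
    case True
    then show ?thesis using reflectsD(2)[OF t] by simp
  next
    case False
    have "\<alpha> \<in> \<Phi>" using that by (simp add: inversion_iff pos_root_iff)
    then show ?thesis
      using infinite_generate_iff_form_ge_1[OF that False] reflects_refl_of_root(1) False by simp
  qed
  moreover have "\<beta> \<in> N p" using refl_prefix_cases[OF \<beta> t p] by blast
  ultimately show ?thesis unfolding Dom_eq_form_ge_1 by auto
qed

end

text \<open>Turns a set indexed by reflections into a set of roots, along the bijection between the
  two.\<close>

lemma reflection_roots_eq:
  assumes "A \<subseteq> \<Phi>\<^sub>p"
  shows "{root_of_refl W S B a act s | s. s \<in> reflections W S \<and>
      root_of_refl W S B a act s \<in> A \<and> P s} = {\<alpha> \<in> A. P (refl_of_root W S B act \<alpha>)}"
proof (intro equalityI subsetI)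
  fix \<alpha> assume "\<alpha> \<in> {root_of_refl W S B a act s | s. s \<in> reflections W S \<and>
      root_of_refl W S B a act s \<in> A \<and> P s}"
  then obtain s where s: "s \<in> reflections W S" "\<alpha> = root_of_refl W S B a act s" "\<alpha> \<in> A" "P s"
    by blast
  obtain \<delta> where \<delta>: "\<delta> \<in> \<Phi>\<^sub>p" "reflects s \<delta>" using reflection_pos_root[OF s(1)] .
  then have "\<alpha> = \<delta>" using root_of_refl_eq s by simp
  then have "refl_of_root W S B act \<alpha> = s" using refl_of_root_eq s \<delta> by simp
  with s show "\<alpha> \<in> {\<alpha> \<in> A. P (refl_of_root W S B act \<alpha>)}" by simp
next
  fix \<alpha> assume \<alpha>: "\<alpha> \<in> {\<alpha> \<in> A. P (refl_of_root W S B act \<alpha>)}"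
  define s where "s = refl_of_root W S B act \<alpha>"
  have s: "s \<in> reflections W S" "reflects s \<alpha>"
    using \<alpha> assms reflects_refl_of_root unfolding s_def by (auto simp: pos_root_iff)
  then have "root_of_refl W S B a act s = \<alpha>" using root_of_refl_eq \<alpha> assms by blast
  with s \<alpha> show "\<alpha> \<in> {root_of_refl W S B a act s | s. s \<in> reflections W S \<and>
      root_of_refl W S B a act s \<in> A \<and> P s}"
    unfolding s_def by force
qed

end

theorem proposition3p14:
  fixes W :: "('g, 'm) monoid_scheme"
    and S :: "'g set"
    and B :: "'v::real_vector \<Rightarrow> 'v \<Rightarrow> real"
    and a :: "'g \<Rightarrow> 'v"
    and act :: "'g \<Rightarrow> 'v \<Rightarrow> 'v"
    and \<beta> :: 'v
    and t p :: 'g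
  assumes "geometric_representation W S B a act"
    and "\<beta> \<in> pos_roots W S a act"
    and "t = refl_of_root W S B act \<beta>"
    and "is_prefix_of_refl W S t p"
  shows "let D = {root_of_refl W S B a act s | s. s \<in> reflections W S \<and>
        root_of_refl W S B a act s \<in> inversions W S a act p \<and> infinite (generate W {s, t})}
    in Dom W S a act \<beta> = {\<alpha> \<in> inversions W S a act p. B \<alpha> \<beta> \<ge> 1} \<and>
       Dom W S a act \<beta> = {\<beta>} \<union> D \<and> \<beta> \<notin> D \<and>
       dp_inf W S a act \<beta> = int (card D)"
proof -
  interpret geometric_representation W S B a act by fact
  define D where "D = {root_of_refl W S B a act s | s. s \<in> reflections W S \<and>
        root_of_refl W S B a act s \<in> inversions W S a act p \<and> infinite (generate W {s, t})}"
  have t: "reflects t \<beta>"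
    using reflects_refl_of_root assms(2,3) by (simp add: pos_root_iff)
  have D: "D = {\<alpha> \<in> N p. infinite (generate W {refl_of_root W S B act \<alpha>, t})}"
    unfolding D_def by (rule reflection_roots_eq) (auto simp: inversion_iff)
  have Dom: "Dom W S a act \<beta> = insert \<beta> D"
    unfolding D by (rule Dom_eq_infinite_generate[OF assms(2) t assms(4)])
  \<comment> \<open>The degenerate dihedral case: \<open>t \<otimes> t\<close> is trivial, of order
    1. It excludes \<open>\<beta>\<close> from \<open>D\<close>.\<close>
  have "finite (generate W {t, t})"
    using finite_generate_involutions[of t t] reflectsD(1)[OF t] reflects_square[OF t] by simp
  then have "\<beta> \<notin> D" using assms(3) by (simp add: D)
  \<comment> \<open>Needed for \<open>card (insert \<beta> D)\<close> to exceed
    \<open>card D\<close> by one, since \<open>card\<close> is 0 on infinite sets.\<close>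
  moreover have "finite D"
    using finite_inversions[OF refl_prefix_closed[OF assms(4)]] by (simp add: D)
  ultimately have "dp_inf W S a act \<beta> = int (card D)"
    by (simp add: dp_inf_def Dom)
  with Dom \<open>\<beta> \<notin> D\<close> Dom_eq_form_ge_1[OF assms(2) t assms(4)] show ?thesis
    unfolding D_def[symmetric] Let_def by simp
qed

end
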